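(* Let $x$ be an indeterminate. For all positive integers $n$, $$D_3(n;x):=\det_{0\le i,j\le n-1}\left(2^i\binom {x+i+2j}{2j}+\binom {x-i+2j}{2j}\right)$$ satisfies $$D_3(n;x)=2^{\binom n2+1}\prod _{i=0} ^{n-1}\frac {i!} {(2i)!}\prod _{i=0} ^{\lfloor (n-1)/2\rfloor}(x+4i+3)_{n-2i-1}\prod _{i=0} ^{\lfloor (n-2)/2\rfloor}(x-2i+3n-1)_{n-2i-2}$$ and $$D_3(n;x)=2\prod_{i=1}^n \frac{2^{2i-2} \, \Gamma(i) \, \Gamma(2i+x) \,\Gamma(4i+x-3) \, \Gamma\bigl(\frac{3i+x-1}{2}\bigr)}{\Gamma(2i-1) \,\Gamma(3i+x-1) \, \Gamma(3i+x-2) \, \Gamma\bigl(\frac{i+x+1}{2}\bigr)}.$$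
   Context: The binomial coefficient is $\binom{\alpha}{p}=\frac{\alpha(\alpha-1)\cdots(\alpha-p+1)}{p!}$ if $p\ge 0$ is an integer, and $0$ if $p<0$. The Pochhammer symbol is $(\alpha)_p=\alpha(\alpha+1)\cdots(\alpha+p-1)$ for $p\ge1$ and $(\alpha)_0=1$. Empty products (in particular $\prod_{i=0}^{-1}$) are $1$. The quotients of Gamma functions are understood as the rational functions of $x$ obtained by simplifying using $\Gamma(z+1)=z\Gamma(z)$. *)

theory Defs
  imports
    "HOL-Analysis.Gamma_Function"
    "HOL-Computational_Algebra.Polynomial_Factorial"
    "Jordan_Normal_Form.Determinant"
begin

text \<open>The indeterminate, as an element of the field \<open>\<rat>(x)\<close> of rational functions.\<close>

definition indet :: "rat poly fract" where
  "indet = to_fract [:0, 1:]"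

definition D3 :: "nat \<Rightarrow> 'a::field_char_0 \<Rightarrow> 'a" where
  "D3 n x = Determinant.det (Matrix.mat n n (\<lambda>(i, j).
     2 ^ i * ((x + of_nat i + 2 * of_nat j) gchoose (2 * j))
     + ((x - of_nat i + 2 * of_nat j) gchoose (2 * j))))"

text \<open>
  The formal quotient \<open>\<Gamma>(a) / \<Gamma>(b)\<close> of two arguments \<open>a\<close>, \<open>b\<close> that differ by an integer,
  simplified by means of \<open>\<Gamma>(z + 1) = z \<Gamma>(z)\<close>. If \<open>a - b\<close> is not an integer,
  the value is unspecified.
\<close>

definition Gamma_quot :: "'a::field_char_0 \<Rightarrow> 'a \<Rightarrow> 'a" where
  "Gamma_quot a b =
     (if \<exists>k. a = b + of_nat k then pochhammer b (THE k. a = b + of_nat k)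
      else inverse (pochhammer a (THE k. b = a + of_nat k)))"

lemma Gamma_quot_add_left: "Gamma_quot (b + of_nat k) b = pochhammer b k"
  by (simp add: Gamma_quot_def)

lemma Gamma_quot_add_right: "Gamma_quot a (a + of_nat k) = inverse (pochhammer a k)"
proof (cases "k = 0")
  case True
  then show ?thesis
    using Gamma_quot_add_left[of a 0] by simp
next
  case False
  have "a \<noteq> a + of_nat k + of_nat m" for m
  proof
    assume "a = a + of_nat k + of_nat m"
    then have "(of_nat (k + m) :: 'a) = 0"
      by (simp add: add.assoc)
    then have "k + m = 0"
      by (simp only: of_nat_eq_0_iff)
    with False show False
      by simp
  qed
  then show ?thesis
    by (simp add: Gamma_quot_def)
qed

lemma Gamma_quot_eq_Gamma_divide:
  fixes a b :: complex
  assumes "a \<notin> \<int>\<^sub>\<le>\<^sub>0" "b \<notin> \<int>\<^sub>\<le>\<^sub>0" "a - b \<in> \<int>"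
  shows "Gamma_quot a b = Gamma a / Gamma b"
proof -
  from assms(3) obtain m :: int where m: "a - b = of_int m"
    by (elim Ints_cases)
  show ?thesis
  proof (cases "m \<ge> 0")
    case True
    then have "a = b + of_nat (nat m)"
      using m by (simp add: algebra_simps)
    then show ?thesis
      using Gamma_quot_add_left[of b "nat m"] pochhammer_Gamma[OF assms(2), of "nat m"] by simp
  next
    case False
    then have "b = a + of_nat (nat (- m))"
      using m by (simp add: algebra_simps)
    then show ?thesis
      using Gamma_quot_add_right[of a "nat (- m)"] pochhammer_Gamma[OF assms(1), of "nat (- m)"]
      by simp
  qed
qed

end

theory Submission
  imports Defs
    "HOL-Computational_Algebra.Formal_Laurent_Series"
    "HOL-Computational_Algebra.Field_as_Ring"
begin

text \<open>
  The entry \<open>(i, j)\<close> is the coefficient of \<open>z\<^sup>2\<^sup>j\<close> in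
  \<open>(1 - z)\<^sup>-\<^sup>x\<^sup>-\<^sup>1 (u\<^sup>i + (2/u)\<^sup>i)\<close> with \<open>u = 1 - z\<close>. Since \<open>u + 2/u = t + 3\<close> for
  \<open>t = z (1 + z) / (1 - z)\<close>, row operations turn the determinant into twice that of the
  coefficients of \<open>z\<^sup>2\<^sup>j\<close> in \<open>(1 - z)\<^sup>-\<^sup>x\<^sup>-\<^sup>1 t\<^sup>i\<close>. This is a polynomial in \<open>x\<close> of degree
  \<open>n (n - 1) / 2\<close>, whose leading coefficient comes from the determinant of the
  \<open>1 / (2 j - i)!\<close>, and it remains to exhibit enough roots, with multiplicity, as kernel
  vectors at \<open>x = -s\<close>. The involutions \<open>u \<mapsto> 2/u\<close>, which fixes \<open>t\<close>, and \<open>z \<mapsto> -z\<close> generate a dihedral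
  group of order 8, whose semi-invariants \<open>z (1 - z\<^sup>2)\<close>, \<open>1 + z\<^sup>2\<close> and \<open>z\<^sup>4 - 6 z\<^sup>2 + 1\<close> provide
  them. For small \<open>s\<close> one uses the row combinations with coefficients
  from \<open>t\<^sup>a (1 + t)\<^sup>s\<^sup>-\<^sup>1\<^sup>-\<^sup>2\<^sup>a\<close>, \<open>a\<close> odd, because
  \<open>(1 - z)\<^sup>s\<^sup>-\<^sup>1 t\<^sup>a (1 + t)\<^sup>s\<^sup>-\<^sup>1\<^sup>-\<^sup>2\<^sup>a = (z (1 - z\<^sup>2))\<^sup>a (1 + z\<^sup>2)\<^sup>s\<^sup>-\<^sup>1\<^sup>-\<^sup>2\<^sup>a\<close> is odd in \<open>z\<close>. For large \<open>s\<close> there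
  are column combinations for which the pairing with \<open>t\<^sup>i\<close> is the residue of
  \<open>(1 - t) (1 + t)\<^sup>g t\<^sup>i\<^sup>-\<^sup>m dt\<close>, and this vanishes for reasons of degree.
\<close>

subsection \<open>Power series\<close>

text \<open>This is \<open>(1 - z)^(-x-1)\<close>, because
  \<open>binom(x+k, k) = (-1)^k binom(-x-1, k)\<close>.\<close>

definition neg_binomial_fps :: "'a::field_char_0 \<Rightarrow> 'a fps" where
  "neg_binomial_fps x = Abs_fps (\<lambda>k. (x + of_nat k) gchoose k)"

lemma neg_binomial_fps_step: "neg_binomial_fps (x + 1) * (1 - fps_X) = neg_binomial_fps x"
proof (rule fps_ext)
  fix k
  have "fps_nth (neg_binomial_fps (x + 1) * (1 - fps_X)) k
      = fps_nth (neg_binomial_fps (x + 1)) k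
        - (if k = 0 then 0 else fps_nth (neg_binomial_fps (x + 1)) (k - 1))"
    by (simp add: right_diff_distrib)
  also have "\<dots> = fps_nth (neg_binomial_fps x) k"
    using gbinomial_Suc_Suc[of "x + of_nat k" "k - 1"]
    by (cases k) (simp_all add: neg_binomial_fps_def add_ac)
  finally show "fps_nth (neg_binomial_fps (x + 1) * (1 - fps_X)) k = fps_nth (neg_binomial_fps x) k" .
qed

lemma neg_binomial_fps_mult_power:
  "neg_binomial_fps (x + of_nat i) * (1 - fps_X) ^ i = neg_binomial_fps x"
proof (induction i)
  case (Suc i)
  have "neg_binomial_fps (x + of_nat (Suc i)) * (1 - fps_X) ^ Suc i
      = neg_binomial_fps (x + of_nat i + 1) * (1 - fps_X) * (1 - fps_X) ^ i"
    by (simp add: add_ac mult_ac)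
  then show ?case
    using Suc by (simp only: neg_binomial_fps_step)
qed simp

lemma neg_binomial_fps_minus:
  "neg_binomial_fps (- of_nat (Suc n) :: 'a::field_char_0) = (1 - fps_X) ^ n"
proof -
  have "neg_binomial_fps (- 1 :: 'a) = 1"
  proof (rule fps_ext)
    fix k
    show "fps_nth (neg_binomial_fps (- 1 :: 'a)) k = fps_nth 1 k"
    proof (cases k)
      case (Suc m)
      have "(of_nat m :: 'a) gchoose Suc m = 0"
        by (simp flip: binomial_gbinomial)
      then show ?thesis
        using Suc by (simp add: neg_binomial_fps_def)
    qed (simp add: neg_binomial_fps_def)
  qed
  then show ?thesis
    using neg_binomial_fps_mult_power[of "- of_nat (Suc n) :: 'a" n] by simp
qed

text \<open>Its use rests on \<open>t (1 - z)^2 = z (1 - z^2)\<close> and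
  \<open>(1 + t) (1 - z) = 1 + z^2\<close>: powers of \<open>1 - z\<close> turn \<open>t\<close>
  into an odd series and \<open>1 + t\<close> into an even one.\<close>

definition bilin_fps :: "'a::field_char_0 fps" where
  "bilin_fps = fps_X * (1 + fps_X) * inverse (1 - fps_X)"

lemma inverse_one_minus_X: "(1 - fps_X) * inverse (1 - fps_X :: 'a::field_char_0 fps) = 1"
  by (rule inverse_mult_eq_1') simp

lemma bilin_fps_mult: "bilin_fps * (1 - fps_X) = fps_X * (1 + fps_X)"
  using inverse_one_minus_X by (simp add: bilin_fps_def mult_ac)

lemma one_plus_bilin_fps_mult:
  "(1 + bilin_fps) * (1 - fps_X) = 1 + (fps_X :: 'a::field_char_0 fps)\<^sup>2"
proof -
  have "(1 + bilin_fps) * (1 - fps_X) = 1 - fps_X + bilin_fps * (1 - fps_X :: 'a fps)"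
    by (simp add: algebra_simps)
  then show ?thesis
    unfolding bilin_fps_mult by (simp add: algebra_simps power2_eq_square)
qed

lemma neg_binomial_fps_add:
  "neg_binomial_fps (x + of_nat i) = neg_binomial_fps x * inverse (1 - fps_X) ^ i"
proof -
  have "neg_binomial_fps x * inverse (1 - fps_X) ^ i
      = neg_binomial_fps (x + of_nat i) * ((1 - fps_X) * inverse (1 - fps_X)) ^ i"
    by (subst neg_binomial_fps_mult_power[of x i, symmetric])
       (simp only: power_mult_distrib mult.assoc)
  then show ?thesis
    by (simp only: inverse_one_minus_X) simp
qed

lemma bilin_fps_neq_0: "bilin_fps \<noteq> (0 :: 'a::field_char_0 fps)"
proof
  assume "bilin_fps = (0 :: 'a fps)"
  moreover have "fps_nth (bilin_fps :: 'a fps) 1 = 1"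
    by (simp add: bilin_fps_def mult.assoc fps_mult_nth_0)
  ultimately show False by simp
qed

definition bilin_subst :: "'a::field_char_0 poly \<Rightarrow> 'a fps" where
  "bilin_subst p = poly (map_poly fps_const p) bilin_fps"

lemma map_poly_fps_const_mult:
  "map_poly fps_const (p * q) = map_poly fps_const p * map_poly fps_const (q :: 'a::field_char_0 poly)"
proof -
  have *: "fps_const (sum f A) = (\<Sum>a\<in>A. fps_const (f a :: 'a))" if "finite A" for f :: "nat \<Rightarrow> 'a" and A
    using that by (induction A) (simp_all flip: fps_const_add)
  show ?thesis
    by (rule poly_eqI) (simp add: coeff_map_poly coeff_mult *)
qed

lemma bilin_subst_simps [simp]:
  fixes p q :: "'a::field_char_0 poly"
  shows "bilin_subst (p * q) = bilin_subst p * bilin_subst q"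
  "bilin_subst (p - q) = bilin_subst p - bilin_subst q"
  "bilin_subst (p ^ k) = bilin_subst p ^ k"
  "bilin_subst (1 :: 'a poly) = 1"
  "bilin_subst [:a, b:] = fps_const a + fps_const b * bilin_fps"
  "bilin_subst [:a:] = fps_const a"
proof -
  have m: "bilin_subst (r * s) = bilin_subst r * bilin_subst s" for r s :: "'a poly"
    by (simp add: bilin_subst_def map_poly_fps_const_mult)
  then show "bilin_subst (p * q) = bilin_subst p * bilin_subst q" .
  show "bilin_subst (p - q) = bilin_subst p - bilin_subst q"
  proof -
    have "map_poly fps_const (p - q) = map_poly fps_const p - map_poly fps_const q"
      by (rule poly_eqI) (simp add: coeff_map_poly)
    then show ?thesis by (simp add: bilin_subst_def)
  qed
  show o: "bilin_subst 1 = (1 :: 'a fps)"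
    by (simp add: bilin_subst_def)
  show "bilin_subst (p ^ k) = bilin_subst p ^ k"
    by (induction k) (simp_all add: m o)
qed (simp_all add: bilin_subst_def map_poly_pCons algebra_simps)

lemma bilin_subst_eq_sum:
  assumes "degree p < n"
  shows "bilin_subst p = (\<Sum>k<n. fps_const (coeff p k) * bilin_fps ^ k)"
proof -
  have "bilin_subst p = (\<Sum>k\<le>degree p. fps_const (coeff p k) * bilin_fps ^ k)"
    unfolding bilin_subst_def poly_altdef by (simp add: coeff_map_poly degree_map_poly)
  also have "\<dots> = (\<Sum>k<n. fps_const (coeff p k) * bilin_fps ^ k)"
    using assms by (intro sum.mono_neutral_left) (auto simp: coeff_eq_0)
  finally show ?thesis .
qed

definition moment :: "'a::field_char_0 \<Rightarrow> nat \<Rightarrow> nat \<Rightarrow> 'a" where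
  "moment x i j = fps_nth (neg_binomial_fps x * bilin_fps ^ i) (2 * j)"

text \<open>A row combination is encoded by the polynomial of its weights; forming it multiplies the
  generating function by that polynomial in \<open>t\<close>.\<close>

lemma sum_coeff_moment:
  assumes "degree p < n"
  shows "(\<Sum>k<n. coeff p k * moment x k j) = fps_nth (neg_binomial_fps x * bilin_subst p) (2 * j)"
proof -
  have "neg_binomial_fps x * bilin_subst p
      = (\<Sum>k<n. fps_const (coeff p k) * (neg_binomial_fps x * bilin_fps ^ k))"
    by (simp add: bilin_subst_eq_sum[OF assms] sum_distrib_left mult_ac)
  then show ?thesis
    by (simp add: moment_def fps_sum_nth)
qed

section \<open>Power sums as polynomials in \<open>t\<close>\<close>

fun lucas_poly :: "nat \<Rightarrow> 'a::field_char_0 poly" where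
  "lucas_poly 0 = [:2:]"
| "lucas_poly (Suc 0) = [:3, 1:]"
| "lucas_poly (Suc (Suc i)) = [:3, 1:] * lucas_poly (Suc i) - [:2:] * lucas_poly i"

lemma degree_lucas_poly: "degree (lucas_poly i :: 'a::field_char_0 poly) = i"
  and lead_coeff_lucas_poly: "coeff (lucas_poly i :: 'a poly) i = (if i = 0 then 2 else 1)"
proof (induction i rule: lucas_poly.induct)
  case (3 i)
  let ?p = "[:3, 1:] * lucas_poly (Suc i) :: 'a poly" and ?q = "[:2:] * lucas_poly i :: 'a poly"
  have nz: "lucas_poly (Suc i) \<noteq> (0 :: 'a poly)"
    using 3(2) by (metis coeff_0 nat.simps(3) zero_neq_one)
  have p: "degree ?p = Suc (Suc i)"
    by (subst degree_mult_eq) (use nz 3(1) in auto)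
  have q: "degree ?q \<le> i"
    using degree_mult_le[of "[:2:]" "lucas_poly i :: 'a poly"] 3(3) by simp
  have d: "degree (?p - ?q) = Suc (Suc i)"
    using degree_add_eq_left[of "- ?q" ?p] p q by simp
  { case 1
    show ?case using d by simp
  next
    case 2
    have "coeff ?q (Suc (Suc i)) = 0"
      by (rule coeff_eq_0) (use q in auto)
    moreover have "coeff ?p (Suc (Suc i)) = 1"
      using 3(2) coeff_eq_0[of "lucas_poly (Suc i) :: 'a poly" "Suc (Suc i)"] 3(1)
      by (simp add: mult_pCons_left)
    ultimately show ?case by simp }
qed simp_all

text \<open>The series \<open>1 - z\<close> and \<open>2 / (1 - z)\<close> have sum
  \<open>t + 3\<close> and product 2, so their power sums satisfy the recurrence that defines
  \<open>lucas_poly\<close>.\<close>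

lemma bilin_subst_lucas_poly:
  "bilin_subst (lucas_poly i) = (1 - fps_X) ^ i + fps_const (2 ^ i) * inverse (1 - fps_X :: 'a::field_char_0 fps) ^ i"
proof -
  define u v :: "'a fps" where "u = 1 - fps_X" and "v = inverse (1 - fps_X)"
  have uv: "u * v = 1"
    by (simp add: u_def v_def inverse_one_minus_X)
  have num: "fps_const (numeral k) = (numeral k :: 'a fps)" for k
    by (simp add: numeral_fps_const)
  have pw: "fps_const (2 ^ k) = (2 ^ k :: 'a fps)" for k
    by (simp flip: fps_const_power add: num)
  have "bilin_fps = (1 - u) * (2 - u) * v"
    by (simp add: bilin_fps_def u_def v_def)
  also have "\<dots> = u * (u * v) - 3 * (u * v) + 2 * v"
    by (simp add: algebra_simps)
  finally have w: "3 + bilin_fps = u + 2 * v"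
    by (simp add: uv algebra_simps)
  show ?thesis
  proof (induction i rule: lucas_poly.induct)
    case 1
    then show ?case by (simp flip: fps_const_add)
  next
    case 2
    then show ?case
      using w by (simp add: num u_def v_def)
  next
    case (3 i)
    have "bilin_subst (lucas_poly (Suc (Suc i)))
        = (u + 2 * v) * (u ^ Suc i + 2 ^ Suc i * v ^ Suc i) - 2 * (u ^ i + 2 ^ i * v ^ i)"
      unfolding lucas_poly.simps bilin_subst_simps 3 pw num fps_const_1_eq_1 mult_1_left w[symmetric]
        v_def[symmetric] unfolding u_def[symmetric]
      by (simp only: distrib_left distrib_right mult_ac add_ac)
    also have "\<dots> = u ^ Suc (Suc i) + 2 ^ Suc (Suc i) * v ^ Suc (Suc i)
        + 2 * (u * v - 1) * (u ^ i + 2 ^ i * v ^ i)"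
      by (simp add: algebra_simps)
    finally have "bilin_subst (lucas_poly (Suc (Suc i)))
        = u ^ Suc (Suc i) + 2 ^ Suc (Suc i) * v ^ Suc (Suc i)"
      by (simp only: uv diff_self mult_zero_right mult_zero_left add_0_right)
    then show ?case
      by (simp only: pw u_def v_def)
  qed
qed

text \<open>Multiplying \<open>(1 - z)^(-x-1)\<close> by \<open>(1 - z)^i\<close> or
  \<open>(1 - z)^(-i)\<close> shifts \<open>x\<close> by \<open>-i\<close> or \<open>+i\<close>,
  which yields the two binomials of the entry.\<close>

lemma lucas_row:
  "2 ^ i * ((x + of_nat i + 2 * of_nat j) gchoose (2 * j))
     + ((x - of_nat i + 2 * of_nat j) gchoose (2 * j))
   = (\<Sum>k<Suc i. coeff (lucas_poly i) k * moment x k j)" (is "?l = ?r")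
proof -
  have "?r = fps_nth (neg_binomial_fps x * bilin_subst (lucas_poly i)) (2 * j)"
    by (rule sum_coeff_moment) (simp add: degree_lucas_poly)
  also have "neg_binomial_fps x * bilin_subst (lucas_poly i)
     = neg_binomial_fps (x - of_nat i) + fps_const (2 ^ i) * neg_binomial_fps (x + of_nat i)"
    using neg_binomial_fps_mult_power[of "x - of_nat i" i]
    by (simp add: bilin_subst_lucas_poly neg_binomial_fps_add algebra_simps)
  finally show ?thesis
    by (simp add: neg_binomial_fps_def)
qed

section \<open>Residues in the variable \<open>t\<close>\<close>

lemma bilin_fps_deriv_factor:
  "fps_deriv bilin_fps * (1 - fps_X) ^ 2 = 1 + 2 * fps_X - (fps_X :: 'a::field_char_0 fps) ^ 2"
proof -
  have "fps_deriv (bilin_fps * (1 - fps_X)) = fps_deriv (fps_X * (1 + fps_X) :: 'a fps)"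
    by (simp only: bilin_fps_mult)
  then have "fps_deriv bilin_fps * (1 - fps_X) = 1 + 2 * fps_X + (bilin_fps :: 'a fps)"
    by (simp add: algebra_simps)
  then have "fps_deriv bilin_fps * (1 - fps_X) ^ 2
      = (1 + 2 * fps_X + bilin_fps) * (1 - fps_X :: 'a fps)"
    by (metis mult.assoc power2_eq_square)
  also have "\<dots> = (1 + 2 * fps_X) * (1 - fps_X) + bilin_fps * (1 - fps_X)"
    by (simp only: distrib_right)
  finally show ?thesis
    unfolding bilin_fps_mult by (simp add: algebra_simps power2_eq_square)
qed

lemma bilin_fps_one_minus:
  "(1 - bilin_fps) * (1 - fps_X) = 1 - 2 * fps_X - (fps_X :: 'a::field_char_0 fps) ^ 2"
proof -
  have "(1 - bilin_fps) * (1 - fps_X) = 1 - fps_X - bilin_fps * (1 - fps_X :: 'a fps)"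
    by (simp add: algebra_simps)
  then show ?thesis
    unfolding bilin_fps_mult by (simp add: algebra_simps power2_eq_square)
qed

text \<open>The product of \<open>1 + 2z - z^2\<close>, the numerator of \<open>t'\<close>, and
  \<open>1 - 2z - z^2\<close>, the numerator of \<open>1 - t\<close>. Replacing \<open>z\<close> by
  \<open>-z\<close> swaps the two, so the product is even.\<close>

definition oct_fps :: "'a::field_char_0 fps" where
  "oct_fps = 1 - 6 * fps_X ^ 2 + fps_X ^ 4"

lemma oct_fps_eq:
  "oct_fps = (1 - bilin_fps) * fps_deriv bilin_fps * (1 - fps_X) ^ 3"
proof -
  have "(1 - bilin_fps) * fps_deriv bilin_fps * (1 - fps_X) ^ 3
    = ((1 - bilin_fps) * (1 - fps_X)) * (fps_deriv bilin_fps * (1 - fps_X :: 'a fps) ^ 2)"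
    by (simp add: power2_eq_square power3_eq_cube mult_ac)
  then show ?thesis
    unfolding bilin_fps_deriv_factor bilin_fps_one_minus
    by (simp add: oct_fps_def algebra_simps power2_eq_square power4_eq_xxxx)
qed

text \<open>Up to a nonzero constant, \<open>t^(-q) t'\<close> is the derivative of
  \<open>t^(1-q)\<close>, and derivatives have residue 0. The bound on \<open>q\<close> excludes the
  logarithmic derivative.\<close>

lemma residue_inverse_power:
  fixes t :: "'a::field_char_0 fls"
  assumes "t \<noteq> 0" "q \<ge> 2"
  shows "fls_residue (inverse t ^ q * fls_deriv t) = 0"
proof -
  obtain r where q: "q = Suc (Suc r)"
    using assms(2) by (metis add_2_eq_Suc le_Suc_ex)
  define w where "w = inverse t"
  have tw: "t * w = 1"
    using assms by (simp add: w_def)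
  then have "fls_deriv t * w + t * fls_deriv w = 0"
    using fls_deriv_mult[of t w] by (simp add: add.commute)
  then have "w * (fls_deriv t * w) + (t * w) * fls_deriv w = 0"
    by (metis (no_types) distrib_left mult.assoc mult.left_commute mult_zero_right)
  then have dw: "fls_deriv w = - (w ^ 2 * fls_deriv t)"
    by (simp add: tw power2_eq_square mult_ac add_eq_0_iff)
  have "fls_deriv (w ^ Suc r) = of_nat (Suc r) * w ^ r * fls_deriv w"
    by (simp only: fls_deriv_power) simp
  also have "\<dots> = - (of_nat (Suc r) * (w ^ q * fls_deriv t))"
    by (simp add: dw q power2_eq_square mult_ac)
  finally have "of_nat (Suc r) * (w ^ q * fls_deriv t) = - fls_deriv (w ^ Suc r)"
    by simp
  then have "of_nat (Suc r) * fls_nth (w ^ q * fls_deriv t) (- 1) = 0"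
    by (metis fls_deriv_residue fls_deriv_neg fls_mult_of_nat_nth(1))
  then show ?thesis
    by (simp add: w_def del: of_nat_Suc)
qed

text \<open>
  This is the residue of \<open>(1 - t) (1 + t)\<^sup>g t\<^sup>i\<^sup>-\<^sup>m dt\<close>, in which only powers
  \<open>t\<^sup>k dt\<close> with \<open>k \<le> -2\<close> occur.
\<close>

lemma residue_bilin:
  assumes "g + i + 3 \<le> m"
  shows "fls_residue (fps_to_fls ((1 - bilin_fps) * (1 + bilin_fps) ^ g * bilin_fps ^ i * fps_deriv bilin_fps)
     * inverse (fps_to_fls (bilin_fps :: 'a::field_char_0 fps)) ^ m) = 0"
proof -
  define t where "t = fps_to_fls (bilin_fps :: 'a fps)"
  have t: "t \<noteq> 0"
    by (simp add: t_def bilin_fps_neq_0)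
  have pw: "fls_residue (t ^ k * inverse t ^ m * fls_deriv t) = 0" if "k + 2 \<le> m" for k
  proof -
    have "t ^ k * inverse t ^ m = t ^ k * (inverse t ^ k * inverse t ^ (m - k))"
      using that by (simp flip: power_add)
    also have "\<dots> = inverse t ^ (m - k)"
      using t by (simp add: field_simps)
    finally show ?thesis
      using residue_inverse_power[OF t, of "m - k"] that by simp
  qed
  have "(1 - t) * (1 + t) ^ g * t ^ i * fls_deriv t * inverse t ^ m
     = (\<Sum>l\<le>g. of_nat (g choose l) * (t ^ (i + l) * inverse t ^ m * fls_deriv t)
                - of_nat (g choose l) * (t ^ (i + l + 1) * inverse t ^ m * fls_deriv t))"
    unfolding add.commute[of 1 t] binomial_ring
    by (simp add: sum_distrib_left sum_distrib_right power_add algebra_simps sum_subtractf)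
  then have "fls_residue ((1 - t) * (1 + t) ^ g * t ^ i * fls_deriv t * inverse t ^ m) = 0"
    using assms pw[of "i + l" for l] pw[of "i + l + 1" for l]
    by (simp add: fls_nth_sum del: power_add power_Suc)
  then show ?thesis
    by (simp add: t_def fps_to_fls_power fls_times_fps_to_fls fls_deriv_fps_to_fls)
qed

text \<open>
  After multiplication by \<open>(1 - z)\<^sup>s\<^sup>-\<^sup>1 z\<^sup>-\<^sup>m dz\<close> with \<open>g + s + 2 = 2 m\<close>, this even series becomes
  the differential form \<open>(1 - t) (1 + t)\<^sup>g t\<^sup>-\<^sup>m dt\<close>.
\<close>

definition cokernel_fps :: "nat \<Rightarrow> nat \<Rightarrow> 'a::field_char_0 fps" where
  "cokernel_fps m g = oct_fps * (1 + fps_X\<^sup>2) ^ g * inverse (1 - fps_X\<^sup>2) ^ m"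

text \<open>The coefficient of \<open>z^(m-1)\<close> in a series \<open>f\<close> is the residue of
  \<open>z^(-m) f dz\<close>; expressed through \<open>t\<close>, this is the residue of
  \<open>residue_bilin\<close>.\<close>

lemma cokernel_annihilates:
  assumes "g + s + 2 = 2 * m" "g + i + 3 \<le> m"
  shows "fps_nth (cokernel_fps m g * (1 - fps_X) ^ (s - 1) * bilin_fps ^ i :: 'a::field_char_0 fps) (m - 1) = 0"
proof -
  define u :: "'a fps" where "u = 1 - fps_X"
  let ?T = "bilin_fps :: 'a fps"
  let ?h = "inverse (1 - fps_X\<^sup>2 :: 'a fps)"
  have h: "(1 - fps_X\<^sup>2) * ?h = 1"
    by (rule inverse_mult_eq_1') simp
  have T: "?T * u ^ 2 = fps_X * (1 - fps_X ^ 2)"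
  proof -
    have "?T * u ^ 2 = (?T * (1 - fps_X)) * (1 - fps_X)"
      by (simp add: u_def power2_eq_square mult_ac)
    then show ?thesis
      unfolding bilin_fps_mult by (simp add: algebra_simps power2_eq_square)
  qed
  \<comment> \<open>This trades the pole \<open>z^(-m)\<close> for \<open>t^(-m)\<close>.\<close>
  have X: "fps_X ^ m = ?T ^ m * u ^ (2 * m) * ?h ^ m"
  proof -
    have "?T ^ m * u ^ (2 * m) * ?h ^ m = (?T * u ^ 2) ^ m * ?h ^ m"
      by (simp add: power_mult power_mult_distrib)
    also have "\<dots> = fps_X ^ m * ((1 - fps_X\<^sup>2) * ?h) ^ m"
      unfolding T by (simp only: power_mult_distrib mult_ac)
    finally show ?thesis by (simp add: h)
  qed
  have s: "s \<ge> 1" using assms by simp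
  \<comment> \<open>The factors \<open>1 - z\<close> cancel exactly: three come from
    \<open>oct_fps\<close>, \<open>g\<close> from \<open>(1 + z^2)^g\<close>, and
    \<open>s - 1\<close> are present explicitly.\<close>
  have e: "2 * m = 3 + g + (s - 1)"
    using assms by auto
  let ?R = "(1 - ?T) * (1 + ?T) ^ g * ?T ^ i * fps_deriv ?T"
  have "cokernel_fps m g * (1 - fps_X) ^ (s - 1) * ?T ^ i * ?T ^ m
     = (1 - ?T) * fps_deriv ?T * u ^ 3 * ((1 + ?T) * u) ^ g * ?h ^ m * u ^ (s - 1) * ?T ^ i * ?T ^ m"
    by (simp add: cokernel_fps_def oct_fps_eq one_plus_bilin_fps_mult u_def)
  also have "\<dots> = ?R * (?T ^ m * u ^ (2 * m) * ?h ^ m)"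
    unfolding e power_add power_mult_distrib by (simp only: mult_ac)
  finally have eq: "cokernel_fps m g * (1 - fps_X) ^ (s - 1) * ?T ^ i * ?T ^ m = ?R * fps_X ^ m"
    by (simp only: X)
  define t where "t = fps_to_fls ?T"
  define f where "f = cokernel_fps m g * (1 - fps_X) ^ (s - 1) * ?T ^ i"
  have t: "t \<noteq> 0"
    by (simp add: t_def bilin_fps_neq_0)
  have "fps_to_fls f * t ^ m = fps_to_fls ?R * fls_X ^ m"
    using arg_cong[OF eq, of fps_to_fls]
    by (simp add: t_def f_def fls_times_fps_to_fls fps_to_fls_power)
  then have "fps_to_fls f = fps_to_fls ?R * inverse t ^ m * fls_X ^ m"
    using t by (simp add: field_simps)
  then have "fls_nth (fps_to_fls f) (int m - 1) = fls_residue (fps_to_fls ?R * inverse t ^ m)"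
    by (simp add: fls_X_power_times_conv_shift(2))
  also have "\<dots> = 0"
    unfolding t_def using assms(2) by (rule residue_bilin)
  finally show ?thesis
    using assms by (simp add: f_def nat_diff_distrib)
qed

subsection \<open>Determinants of polynomial matrices\<close>

interpretation to_fract_hom: comm_ring_hom "to_fract :: 'a::idom \<Rightarrow> _"
  by standard auto

lemma det_lower_triangular_mult:
  fixes c :: "nat \<Rightarrow> nat \<Rightarrow> 'a::idom"
  assumes "\<And>i k. i < n \<Longrightarrow> i < k \<Longrightarrow> c i k = 0"
  shows "Determinant.det (Matrix.mat n n (\<lambda>(i, j). \<Sum>k<n. c i k * a k j))
     = (\<Prod>i<n. c i i) * Determinant.det (Matrix.mat n n (\<lambda>(i, j). a i j))"
proof -
  let ?C = "Matrix.mat n n (\<lambda>(i, j). c i j)" and ?A = "Matrix.mat n n (\<lambda>(i, j). a i j)"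
  have "Matrix.mat n n (\<lambda>(i, j). \<Sum>k<n. c i k * a k j) = ?C * ?A"
    by (rule eq_matI) (simp_all add: scalar_prod_def lessThan_atLeast0)
  moreover have "Determinant.det ?C = (\<Prod>i<n. c i i)"
    by (subst det_lower_triangular[of n])
       (auto simp: assms prod_list_diag_prod lessThan_atLeast0)
  ultimately show ?thesis
    by (simp add: det_mult[of _ n])
qed

text \<open>Each \<open>d\<close> in \<open>S\<close> indexes a kernel vector at \<open>r\<close>
  whose last nonzero entry has position \<open>d\<close>. Replacing row \<open>d\<close> by that
  combination scales the determinant by a nonzero constant and makes the row divisible by
  \<open>X - r\<close>. The distinct last positions play the part of linear independence.\<close>

lemma power_dvd_det_rows:
  fixes a :: "nat \<Rightarrow> nat \<Rightarrow> 'a::field poly"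
  assumes S: "S \<subseteq> {..<n}"
    and c: "\<And>d. d \<in> S \<Longrightarrow> c d d \<noteq> 0" "\<And>d k. d \<in> S \<Longrightarrow> d < k \<Longrightarrow> c d k = 0"
    and root: "\<And>d j. d \<in> S \<Longrightarrow> j < n \<Longrightarrow> (\<Sum>k<n. c d k * poly (a k j) r) = 0"
  shows "[:- r, 1:] ^ card S dvd Determinant.det (Matrix.mat n n (\<lambda>(i, j). a i j))"
proof -
  define c' :: "nat \<Rightarrow> nat \<Rightarrow> 'a poly"
    where "c' i k = (if i \<in> S then [:c i k:] else if i = k then 1 else 0)" for i k
  define q :: "nat \<Rightarrow> 'a poly" where "q i = (if i \<in> S then [:- r, 1:] else 1)" for i
  define e where "e i j = (\<Sum>k<n. c' i k * a k j) div q i" for i j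
  have dvd: "q i dvd (\<Sum>k<n. c' i k * a k j)" if "i < n" "j < n" for i j
    using that root[of i j] by (auto simp: q_def c'_def poly_eq_0_iff_dvd[symmetric] poly_sum)
  have qe: "(\<Sum>k<n. c' i k * a k j) = q i * e i j" if "i < n" "j < n" for i j
    using dvd[OF that] by (simp add: e_def)
  have "(\<Prod>i<n. c' i i) * Determinant.det (Matrix.mat n n (\<lambda>(i, j). a i j))
      = Determinant.det (Matrix.mat n n (\<lambda>(i, j). \<Sum>k<n. c' i k * a k j))"
    by (rule det_lower_triangular_mult[symmetric]) (auto simp: c'_def c)
  also have "Matrix.mat n n (\<lambda>(i, j). \<Sum>k<n. c' i k * a k j)
      = Matrix.mat n n (\<lambda>(i, j). \<Sum>k<n. (if i = k then q i else 0) * e k j)"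
    by (rule eq_matI) (auto simp: qe if_distrib[of "\<lambda>x. x * _"] cong: if_cong)
  also have "Determinant.det \<dots> = (\<Prod>i<n. q i) * Determinant.det (Matrix.mat n n (\<lambda>(i, j). e i j))"
    by (subst det_lower_triangular_mult) auto
  also have "(\<Prod>i<n. q i) = [:- r, 1:] ^ card S"
    using S by (simp add: q_def prod.If_cases Int_absorb1)
  finally have *: "[:- r, 1:] ^ card S dvd
      (\<Prod>i<n. c' i i) * Determinant.det (Matrix.mat n n (\<lambda>(i, j). a i j))"
    by simp
  have "is_unit (\<Prod>i<n. c' i i)"
    using prod_dvd_prod[of "{..<n}" "\<lambda>i. c' i i" "\<lambda>_. 1"]
    by (auto simp: c'_def c is_unit_const_poly_iff dvd_field_iff)
  with * show ?thesis
    by (simp add: dvd_mult_unit_iff')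
qed

lemma power_dvd_det_cols:
  fixes a :: "nat \<Rightarrow> nat \<Rightarrow> 'a::field poly"
  assumes "S \<subseteq> {..<n}"
    and "\<And>d. d \<in> S \<Longrightarrow> c d d \<noteq> 0" "\<And>d k. d \<in> S \<Longrightarrow> d < k \<Longrightarrow> c d k = 0"
    and "\<And>d i. d \<in> S \<Longrightarrow> i < n \<Longrightarrow> (\<Sum>k<n. c d k * poly (a i k) r) = 0"
  shows "[:- r, 1:] ^ card S dvd Determinant.det (Matrix.mat n n (\<lambda>(i, j). a i j))"
proof -
  have "Determinant.det (Matrix.mat n n (\<lambda>(i, j). a i j))
      = Determinant.det (Matrix.mat n n (\<lambda>(i, j). a j i))"
    by (subst det_transpose[of _ n, symmetric]) (auto intro!: arg_cong[of _ _ Determinant.det])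
  then show ?thesis
    using power_dvd_det_rows[OF assms(1), of c "\<lambda>i j. a j i" r] assms(2-4) by simp
qed

section \<open>Products of linear factors\<close>

lemma coprime_linear_poly:
  fixes a b :: "'a::field_gcd"
  assumes "a \<noteq> b"
  shows "coprime [:- a, 1:] [:- b, 1:]"
proof (rule coprimeI)
  fix c
  assume "c dvd [:- a, 1:]" "c dvd [:- b, 1:]"
  then have "c dvd [:- a, 1:] - [:- b, 1:]"
    by (rule dvd_diff)
  moreover have "is_unit ([:- a, 1:] - [:- b, 1:])"
    using assms by (simp add: is_unit_const_poly_iff dvd_field_iff)
  ultimately show "is_unit c"
    using dvd_trans by blast
qed

text \<open>Linear factors with different roots are coprime, so divisibility can be checked one root
  at a time; the fibre of \<open>e\<close> over \<open>r\<close> counts the multiplicity of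
  \<open>r\<close>.\<close>

lemma prod_linear_dvd:
  fixes e :: "'i \<Rightarrow> 'a::field_gcd" and D :: "'a poly"
  assumes I: "finite I" and D: "\<And>r. [:- r, 1:] ^ card {p \<in> I. e p = r} dvd D"
  shows "(\<Prod>p\<in>I. [:- e p, 1:]) dvd D"
proof -
  have "(\<Prod>r\<in>R. [:- r, 1:] ^ card {p \<in> I. e p = r}) dvd D" if "finite R" for R
    using that
  proof (induction R)
    case (insert r R)
    have "coprime ([:- r, 1:] ^ card {p \<in> I. e p = r}) (\<Prod>r\<in>R. [:- r, 1:] ^ card {p \<in> I. e p = r})"
      using insert(2) by (intro prod_coprime_right coprime_power_left_iff[THEN iffD2]
         coprime_power_right_iff[THEN iffD2] disjI1 coprime_linear_poly) auto
    then show ?case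
      using insert D by (auto intro: divides_mult)
  qed simp
  from this[of "e ` I"] I have "(\<Prod>r\<in>e ` I. [:- r, 1:] ^ card {p \<in> I. e p = r}) dvd D"
    by simp
  also have "(\<Prod>r\<in>e ` I. [:- r, 1:] ^ card {p \<in> I. e p = r})
      = (\<Prod>r\<in>e ` I. \<Prod>p\<in>{p \<in> I. e p = r}. [:- e p, 1:])"
    by (rule prod.cong) auto
  also have "\<dots> = (\<Prod>p\<in>I. [:- e p, 1:])"
    using I by (rule prod.image_gen[symmetric])
  finally show ?thesis .
qed

section \<open>Top coefficients of determinants\<close>

lemma coeff_prod_degree_le:
  fixes f :: "'i \<Rightarrow> 'a::comm_semiring_1 poly"
  assumes "finite I" "\<And>i. i \<in> I \<Longrightarrow> degree (f i) \<le> d i"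
  shows "degree (prod f I) \<le> sum d I" "coeff (prod f I) (sum d I) = (\<Prod>i\<in>I. coeff (f i) (d i))"
proof -
  have "degree (prod f I) \<le> sum d I \<and> coeff (prod f I) (sum d I) = (\<Prod>i\<in>I. coeff (f i) (d i))"
    using assms
  proof (induction I rule: finite_induct)
    case (insert i I)
    then have IH: "degree (prod f I) \<le> sum d I" "coeff (prod f I) (sum d I) = (\<Prod>i\<in>I. coeff (f i) (d i))"
      and i: "degree (f i) \<le> d i"
      by auto
    have "degree (f i * prod f I) \<le> d i + sum d I"
      using degree_mult_le[of "f i" "prod f I"] IH i by linarith
    moreover have "coeff (f i * prod f I) (d i + sum d I) = coeff (f i) (d i) * coeff (prod f I) (sum d I)"
    proof -
      have "coeff (f i) k * coeff (prod f I) (d i + sum d I - k) = 0" if "k \<noteq> d i" "k \<le> d i + sum d I" for k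
      proof (cases "k < d i")
        case True
        then have "sum d I < d i + sum d I - k"
          using that by simp
        then show ?thesis
          using IH(1) by (simp add: coeff_eq_0)
      next
        case False
        then show ?thesis
          using i that by (simp add: coeff_eq_0)
      qed
      then have "(\<Sum>k\<le>d i + sum d I. coeff (f i) k * coeff (prod f I) (d i + sum d I - k))
         = (\<Sum>k\<in>{d i}. coeff (f i) k * coeff (prod f I) (d i + sum d I - k))"
        by (intro sum.mono_neutral_right) auto
      then show ?thesis
        by (simp add: coeff_mult)
    qed
    ultimately show ?case
      using insert IH by simp
  qed simp
  then show "degree (prod f I) \<le> sum d I" "coeff (prod f I) (sum d I) = (\<Prod>i\<in>I. coeff (f i) (d i))"
    by auto
qed

text \<open>In the Leibniz expansion the degree bounds \<open>b (p i) - i\<close> add up to the same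
  \<open>N\<close> for every permutation \<open>p\<close>, so the coefficient at \<open>N\<close> is
  formed entrywise.\<close>

lemma det_graded:
  fixes a :: "nat \<Rightarrow> nat \<Rightarrow> 'a::idom poly" and b :: "nat \<Rightarrow> nat"
  assumes deg: "\<And>i j. i < n \<Longrightarrow> j < n \<Longrightarrow> degree (a i j) \<le> b j - i"
    and zero: "\<And>i j. i < n \<Longrightarrow> j < n \<Longrightarrow> b j < i \<Longrightarrow> a i j = 0"
    and N: "N + \<Sum>{..<n} = sum b {..<n}"
  shows "degree (Determinant.det (Matrix.mat n n (\<lambda>(i, j). a i j))) \<le> N"
    and "coeff (Determinant.det (Matrix.mat n n (\<lambda>(i, j). a i j))) N
       = Determinant.det (Matrix.mat n n (\<lambda>(i, j). coeff (a i j) (b j - i)))"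
proof -
  let ?A = "Matrix.mat n n (\<lambda>(i, j). a i j)" and ?L = "Matrix.mat n n (\<lambda>(i, j). coeff (a i j) (b j - i))"
  have *: "degree (\<Prod>i = 0..<n. a i (p i)) \<le> N \<and>
     coeff (\<Prod>i = 0..<n. a i (p i)) N = (\<Prod>i = 0..<n. coeff (a i (p i)) (b (p i) - i))"
    if p: "p permutes {0..<n}" for p
  \<comment> \<open>Where the natural subtraction would truncate, the entry is 0 and both products
    vanish.\<close>
  proof (cases "\<exists>i<n. b (p i) < i")
    case True
    then obtain i where i: "i < n" "b (p i) < i" by blast
    then have "a i (p i) = 0"
      using zero p by (metis atLeastLessThan_iff permutes_in_image zero_le)
    then have z: "(\<Prod>i = 0..<n. a i (p i)) = 0" "(\<Prod>i = 0..<n. coeff (a i (p i)) (b (p i) - i)) = 0"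
      using i by (auto intro!: prod_zero bexI[of _ i])
    show ?thesis
      unfolding z by simp
  next
    case False
    have pn: "p i < n" if "i < n" for i
      using permutes_in_image[OF p, of i] that by simp
    have "(\<Sum>i = 0..<n. b (p i) - i) + (\<Sum>i = 0..<n. i) = (\<Sum>i = 0..<n. b (p i))"
      using False by (subst sum.distrib[symmetric], intro sum.cong) auto
    also have "\<dots> = (\<Sum>i = 0..<n. b i)"
      by (rule sum.permute[OF p, of b, unfolded comp_def, symmetric])
    finally have N': "(\<Sum>i = 0..<n. b (p i) - i) = N"
      using N by (simp add: lessThan_atLeast0)
    show ?thesis
      using coeff_prod_degree_le[of "{0..<n}" "\<lambda>i. a i (p i)" "\<lambda>i. b (p i) - i"] deg pn
      unfolding N' by auto
  qed
  have sgn: "degree (signof p * q) \<le> N" if "degree q \<le> N" for p and q :: "'a poly"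
    using that by (simp add: sign_def)
  have sgnc: "coeff (signof p * q) N = signof p * coeff q N" for p and q :: "'a poly"
    by (simp add: sign_def)
  have A: "Determinant.det ?A = (\<Sum>p | p permutes {0..<n}. signof p * (\<Prod>i = 0..<n. a i (p i)))"
    by (subst det_def'[of _ n])
       (auto intro!: sum.cong prod.cong simp: permutes_in_image)
  have L: "Determinant.det ?L
     = (\<Sum>p | p permutes {0..<n}. signof p * (\<Prod>i = 0..<n. coeff (a i (p i)) (b (p i) - i)))"
    by (subst det_def'[of _ n])
       (auto intro!: sum.cong prod.cong simp: permutes_in_image)
  show "degree (Determinant.det ?A) \<le> N"
    unfolding A using * by (intro degree_sum_le sgn) (auto intro: finite_permutations)
  show "coeff (Determinant.det ?A) N = Determinant.det ?L"
    unfolding A L coeff_sum sgnc using * by (auto intro!: sum.cong)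
qed

subsection \<open>The leading coefficient\<close>

text \<open>Here \<open>t^i = z^i (1 + z)^i (1 - z)^(-i)\<close>, and the last factor is absorbed
  into \<open>x\<close>. The result shows the dependence on \<open>x\<close> to be
  polynomial.\<close>

lemma moment_eq_sum:
  "moment x i j = (if 2 * j < i then 0 else
     \<Sum>k = 0..2 * j - i. of_nat (i choose k)
        * (pochhammer (x + of_nat i + 1) (2 * j - i - k) / fact (2 * j - i - k)))"
proof -
  have "neg_binomial_fps x * bilin_fps ^ i
      = fps_X ^ i * ((1 + fps_X) ^ i * neg_binomial_fps (x + of_nat i))"
    by (simp add: bilin_fps_def neg_binomial_fps_add power_mult_distrib mult_ac)
  then have "moment x i j = (if 2 * j < i then 0 else
      fps_nth ((1 + fps_X) ^ i * neg_binomial_fps (x + of_nat i)) (2 * j - i))"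
    by (simp only: moment_def fps_X_power_mult_nth)
  moreover have "fps_nth ((1 + fps_X) ^ i) k = (of_nat (i choose k) :: 'a)" for k
    by (simp flip: fps_binomial_of_nat binomial_gbinomial)
  moreover have "fps_nth (neg_binomial_fps (x + of_nat i)) m
      = pochhammer (x + of_nat i + 1) m / fact m" for m
    by (simp add: neg_binomial_fps_def gbinomial_pochhammer')
  ultimately show ?thesis
    by (simp only: fps_mult_nth)
qed

definition moment_poly :: "nat \<Rightarrow> nat \<Rightarrow> rat poly" where
  "moment_poly i j = (if 2 * j < i then 0 else
     \<Sum>k = 0..2 * j - i. smult (of_nat (i choose k) / fact (2 * j - i - k))
        (pochhammer [:of_nat i + 1, 1:] (2 * j - i - k)))"

text \<open>This serves two homomorphisms: the embedding into the rational functions, and evaluation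
  at the rational points where kernel vectors are exhibited.\<close>

lemma hom_moment_poly:
  fixes h :: "rat poly \<Rightarrow> 'a::field_char_0"
  assumes "comm_ring_hom h"
  shows "h (moment_poly i j) = moment (h [:0, 1:]) i j"
proof -
  interpret comm_ring_hom h by fact
  have nat: "h (of_nat k) = of_nat k" for k
    by (induction k) (simp_all add: hom_add)
  have poch: "h (pochhammer a k) = pochhammer (h a) k" for a k
    by (induction k) (simp_all add: pochhammer_Suc hom_mult hom_add nat)
  have lin: "h [:of_nat i + 1, 1:] = h [:0, 1:] + of_nat i + 1"
  proof -
    have "[:of_nat i + 1, 1:] = [:0, 1:] + of_nat i + (1 :: rat poly)"
      by (simp add: of_nat_poly one_pCons)
    then show ?thesis
      by (simp only: hom_add nat hom_one)
  qed
  have scal: "h (smult (of_nat a / fact m) p) = of_nat a * (h p / fact m)" for a m p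
  proof -
    \<comment> \<open>The value of \<open>h\<close> is known on integers, so denominators are
      cleared before \<open>h\<close> is applied.\<close>
    have "of_nat (fact m) * smult (of_nat a / fact m) p = of_nat a * p"
      by (simp add: of_nat_poly)
    then have "h (of_nat (fact m) * smult (of_nat a / fact m) p) = h (of_nat a * p)"
      by simp
    then have "of_nat (fact m) * h (smult (of_nat a / fact m) p) = of_nat a * h p"
      by (simp only: hom_mult nat)
    then show ?thesis
      by (simp add: field_simps)
  qed
  show ?thesis
    by (simp add: moment_poly_def moment_eq_sum hom_sum scal poch lin del: smult_pCons)
qed

lemma degree_pochhammer_linear:
  "degree (pochhammer [:a, 1:] m :: rat poly) = m"
  "lead_coeff (pochhammer [:a, 1:] m :: rat poly) = 1"
proof -
  have *: "[:a, 1:] + of_nat k = [:a + of_nat k, 1 :: rat:]" for k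
    by (simp add: of_nat_poly)
  show "degree (pochhammer [:a, 1:] m :: rat poly) = m"
    by (simp add: pochhammer_prod * degree_prod_sum_eq)
  show "lead_coeff (pochhammer [:a, 1:] m :: rat poly) = 1"
    unfolding pochhammer_prod * lead_coeff_prod by simp
qed

lemma degree_moment_poly: "degree (moment_poly i j) \<le> 2 * j - i"
  unfolding moment_poly_def
  by (auto intro!: degree_sum_le order.trans[OF degree_smult_le] simp: degree_pochhammer_linear)

text \<open>Only \<open>k = 0\<close> reaches the full degree and contributes
  \<open>1 / (2j - i)!\<close>. The binomial form also covers \<open>2j < i\<close> and separates
  the row factor \<open>i!\<close> from the column factor \<open>1 / (2j)!\<close>.\<close>

lemma coeff_moment_poly:
  "coeff (moment_poly i j) (2 * j - i) = fact i * of_nat ((2 * j) choose i) / fact (2 * j)"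
proof (cases "2 * j < i")
  case True
  then show ?thesis by (simp add: moment_poly_def)
next
  case False
  let ?m = "2 * j - i"
  have "coeff (moment_poly i j) ?m = (\<Sum>k = 0..?m. of_nat (i choose k) / fact (?m - k)
      * coeff (pochhammer [:of_nat i + 1, 1:] (?m - k)) ?m)"
    using False by (simp add: moment_poly_def coeff_sum)
  also have "\<dots> = (\<Sum>k\<in>{0}. of_nat (i choose k) / fact (?m - k)
      * coeff (pochhammer [:of_nat i + 1, 1:] (?m - k)) ?m)"
    by (rule sum.mono_neutral_right)
       (auto intro!: coeff_eq_0 simp: degree_pochhammer_linear)
  also have "\<dots> = 1 / fact ?m"
    using degree_pochhammer_linear[of "of_nat i + 1" ?m] by simp
  also have "\<dots> = fact i * of_nat ((2 * j) choose i) / fact (2 * j)"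
    using False by (simp add: binomial_fact)
  finally show ?thesis .
qed

text \<open>Compare coefficients of \<open>z^i\<close> in
  \<open>(1 + z)^(2j) = (1 + z (2 + z))^j\<close>.\<close>

lemma binomial_double_expand:
  assumes "i < n"
  shows "(of_nat ((2 * j) choose i) :: rat)
    = (\<Sum>k<n. fps_nth (fps_X ^ k * (2 + fps_X) ^ k) i * of_nat (j choose k))"
proof -
  have bin: "fps_nth ((1 + fps_X) ^ m) k = (of_nat (m choose k) :: rat)" for k m
    by (simp flip: fps_binomial_of_nat binomial_gbinomial)
  have "(1 + fps_X :: rat fps) ^ (2 * j) = (fps_X * (2 + fps_X) + 1) ^ j"
  proof -
    have "(1 + fps_X :: rat fps)\<^sup>2 = fps_X * (2 + fps_X) + 1"
      by (simp add: power2_eq_square algebra_simps)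
    then show ?thesis by (simp only: power_mult)
  qed
  also have "\<dots> = (\<Sum>k\<le>j. of_nat (j choose k) * (fps_X ^ k * (2 + fps_X) ^ k))"
    by (simp add: binomial_ring power_mult_distrib)
  finally have "of_nat ((2 * j) choose i)
     = (\<Sum>k\<le>j. fps_nth (of_nat (j choose k) * (fps_X ^ k * (2 + fps_X :: rat fps) ^ k)) i)"
    by (simp flip: bin add: fps_sum_nth)
  also have "\<dots> = (\<Sum>k\<le>j. fps_nth (fps_X ^ k * (2 + fps_X) ^ k) i * of_nat (j choose k))"
    by (simp only: fps_mult_of_nat_nth mult.commute)
  \<comment> \<open>Terms with \<open>k > j\<close> vanish through the binomial, those with
    \<open>k >= n > i\<close> through \<open>z^k\<close>; the larger range accommodates
    both.\<close>
  also have "\<dots> = (\<Sum>k<max n (Suc j). fps_nth (fps_X ^ k * (2 + fps_X) ^ k) i * of_nat (j choose k))"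
    by (rule sum.mono_neutral_left) auto
  also have "\<dots> = (\<Sum>k<n. fps_nth (fps_X ^ k * (2 + fps_X) ^ k) i * of_nat (j choose k))"
    using assms by (intro sum.mono_neutral_right) (auto simp: fps_X_power_mult_nth)
  finally show ?thesis .
qed

text \<open>The matrix is a lower triangular one with diagonal \<open>i! 2^i\<close> times an upper
  triangular one with diagonal \<open>1 / (2i)!\<close>.\<close>

lemma det_leading_coeffs:
  "Determinant.det (Matrix.mat n n (\<lambda>(i, j). coeff (moment_poly i j) (2 * j - i)))
   = 2 ^ \<Sum>{..<n} * (\<Prod>i<n. fact i / fact (2 * i))"
proof -
  define c :: "nat \<Rightarrow> nat \<Rightarrow> rat"
    where "c i k = fact i * fps_nth (fps_X ^ k * (2 + fps_X) ^ k) i" for i k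
  let ?B = "Matrix.mat n n (\<lambda>(k, j). of_nat (j choose k) / fact (2 * j) :: rat)"
  have "coeff (moment_poly i j) (2 * j - i)
      = (\<Sum>k<n. c i k * (of_nat (j choose k) / fact (2 * j)))" if "i < n" for i j
    unfolding coeff_moment_poly binomial_double_expand[OF that] c_def
    by (simp add: sum_distrib_left sum_divide_distrib mult_ac)
  then have "Matrix.mat n n (\<lambda>(i, j). coeff (moment_poly i j) (2 * j - i))
      = Matrix.mat n n (\<lambda>(i, j). \<Sum>k<n. c i k * (of_nat (j choose k) / fact (2 * j)))"
    by (intro eq_matI) auto
  also have "Determinant.det \<dots> = (\<Prod>i<n. c i i) * Determinant.det ?B"
    by (rule det_lower_triangular_mult) (simp add: c_def fps_X_power_mult_nth)
  also have "Determinant.det ?B = (\<Prod>i<n. 1 / fact (2 * i))"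
    by (subst det_upper_triangular[of _ n])
       (auto simp: prod_list_diag_prod lessThan_atLeast0)
  also have "(\<Prod>i<n. c i i) = (\<Prod>i<n. fact i * 2 ^ i)"
    by (simp add: c_def fps_X_power_mult_nth fps_power_zeroth)
  finally show ?thesis
    by (simp add: prod.distrib prod_dividef power_sum)
qed

subsection \<open>The roots\<close>

definition even_fps :: "'a::field_char_0 fps \<Rightarrow> bool" where
  "even_fps f \<longleftrightarrow> (\<forall>k. odd k \<longrightarrow> fps_nth f k = 0)"

lemma even_fps_mult: "even_fps f \<Longrightarrow> even_fps g \<Longrightarrow> even_fps (f * g)"
  unfolding even_fps_def fps_mult_nth
  by (intro allI impI sum.neutral ballI) (metis atLeastAtMost_iff le_add_diff_inverse mult_eq_0_iff odd_add)

lemma even_fps_power: "even_fps f \<Longrightarrow> even_fps (f ^ k)"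
  by (induction k) (auto simp: even_fps_mult, simp add: even_fps_def)

lemma even_fps_X_power: "even k \<Longrightarrow> even_fps (fps_X ^ k)"
  by (auto simp: even_fps_def fps_X_power_nth)

lemma even_fps_inverse: "even_fps (inverse (1 - fps_X\<^sup>2) :: 'a::field_char_0 fps)"
proof -
  define f :: "'a fps" where "f = Abs_fps (\<lambda>k. if even k then 1 else 0)"
  have "f * (1 - fps_X\<^sup>2) = 1"
    by (rule fps_ext) (auto simp: f_def right_diff_distrib fps_X_power_mult_right_nth)
  then have "inverse (1 - fps_X\<^sup>2) = f"
    by (metis fps_inverse_unique mult.commute)
  then show ?thesis
    by (simp add: f_def even_fps_def)
qed

lemma even_fps_cokernel: "even_fps (cokernel_fps m g)"
proof -
  have "even_fps (1 - 6 * fps_X ^ 2 + fps_X ^ 4 :: 'a fps)"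
    by (auto simp: even_fps_def numeral_fps_const fps_X_power_nth)
  moreover have "even_fps (1 + fps_X\<^sup>2 :: 'a fps)"
    by (auto simp: even_fps_def fps_X_power_nth)
  ultimately show ?thesis
    unfolding cokernel_fps_def oct_fps_def
    by (intro even_fps_mult even_fps_power even_fps_inverse)
qed

text \<open>An even factor meets only the even coefficients of \<open>g\<close>, so a coefficient of
  the product becomes a combination of columns \<open>0..d\<close>.\<close>

lemma nth_even_mult_double:
  assumes "even_fps f"
  shows "fps_nth (f * g) (2 * d) = (\<Sum>j\<le>d. fps_nth f (2 * (d - j)) * fps_nth g (2 * j))"
proof -
  have "fps_nth (f * g) (2 * d) = (\<Sum>j\<le>2 * d. fps_nth g j * fps_nth f (2 * d - j))"
    by (subst mult.commute) (simp add: fps_mult_nth atMost_atLeast0)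
  also have "\<dots> = (\<Sum>j\<in>(\<lambda>j. 2 * j) ` {..d}. fps_nth g j * fps_nth f (2 * d - j))"
  proof (rule sum.mono_neutral_right)
    show "\<forall>i\<in>{..2 * d} - (\<lambda>j. 2 * j) ` {..d}. fps_nth g i * fps_nth f (2 * d - i) = 0"
    proof
      fix i
      assume i: "i \<in> {..2 * d} - (\<lambda>j. 2 * j) ` {..d}"
      then have "odd i"
        by (auto elim!: evenE)
      then have "odd (2 * d - i)"
        using i by simp
      then show "fps_nth g i * fps_nth f (2 * d - i) = 0"
        using assms by (simp add: even_fps_def)
    qed
  qed auto
  also have "\<dots> = (\<Sum>j\<le>d. fps_nth f (2 * (d - j)) * fps_nth g (2 * j))"
    by (subst sum.reindex) (auto simp: inj_on_def diff_mult_distrib2 mult.commute[of "fps_nth g _"])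
  finally show ?thesis .
qed

text \<open>The \<open>s - 1 = 2a + g\<close> factors \<open>1 - z\<close> are used up, two for each
  \<open>t\<close> and one for each \<open>1 + t\<close>. What remains is odd in \<open>z\<close>
  because \<open>a\<close> is odd.\<close>

lemma kernel_annihilates:
  assumes "odd a" "s = Suc (2 * a + g)"
  shows "fps_nth (neg_binomial_fps (- of_nat s :: 'a::field_char_0)
      * bilin_subst ([:0, 1:] ^ a * [:1, 1:] ^ g)) (2 * j) = 0"
proof -
  from assms(1) obtain i where i: "a = Suc (2 * i)"
    by (auto elim: oddE)
  let ?T = "bilin_fps :: 'a fps" and ?u = "1 - fps_X :: 'a fps"
  have "neg_binomial_fps (- of_nat s) * bilin_subst ([:0, 1:] ^ a * [:1, 1:] ^ g)
     = (?T * ?u * ?u) ^ a * ((1 + ?T) * ?u) ^ g"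
    unfolding assms(2) neg_binomial_fps_minus
    by (simp add: power_add power_mult_distrib power_mult power2_eq_square mult_ac)
  also have "\<dots> = (fps_X * (1 - fps_X\<^sup>2)) ^ a * (1 + fps_X\<^sup>2) ^ g"
    unfolding bilin_fps_mult one_plus_bilin_fps_mult
    by (simp add: algebra_simps power2_eq_square)
  also have "\<dots> = fps_X * (fps_X ^ (2 * i) * (1 - fps_X\<^sup>2) ^ a * (1 + fps_X\<^sup>2) ^ g)"
    by (simp add: i power_mult_distrib mult_ac)
  also have "fps_nth \<dots> (2 * j) = 0"
  proof -
    have "even_fps (1 - fps_X\<^sup>2 :: 'a fps)" "even_fps (1 + fps_X\<^sup>2 :: 'a fps)"
      by (auto simp: even_fps_def fps_X_power_nth)
    then have "even_fps (fps_X ^ (2 * i) * (1 - fps_X\<^sup>2) ^ a * (1 + fps_X\<^sup>2 :: 'a fps) ^ g)"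
      by (intro even_fps_mult even_fps_power even_fps_X_power) auto
    then show ?thesis
      by (cases j) (auto simp: even_fps_def)
  qed
  finally show ?thesis .
qed

definition moment_det :: "nat \<Rightarrow> rat poly" where
  "moment_det n = Determinant.det (Matrix.mat n n (\<lambda>(i, j). moment_poly i j))"

lemma poly_moment_poly: "poly (moment_poly i j) r = moment r i j"
proof -
  have "comm_ring_hom (\<lambda>p. poly p r)"
    by standard auto
  then show ?thesis
    using hom_moment_poly[of "\<lambda>p. poly p r" i j] by simp
qed

lemma moment_poly_eq_0: "2 * j < i \<Longrightarrow> moment_poly i j = 0"
  by (simp add: moment_poly_def)

lemma D3_eq_moment_det:
  assumes "n \<ge> 1"
  shows "D3 n indet = 2 * to_fract (moment_det n)"
proof -
  let ?c = "\<lambda>i k. coeff (lucas_poly i) k :: rat poly fract"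
  have "2 ^ i * ((indet + of_nat i + 2 * of_nat j) gchoose (2 * j))
       + ((indet - of_nat i + 2 * of_nat j) gchoose (2 * j))
     = (\<Sum>k<n. ?c i k * moment indet k j)" if "i < n" for i j
    unfolding lucas_row using that
    by (intro sum.mono_neutral_left) (auto simp: coeff_eq_0 degree_lucas_poly)
  then have "D3 n indet = Determinant.det (Matrix.mat n n (\<lambda>(i, j). \<Sum>k<n. ?c i k * moment indet k j))"
    unfolding D3_def by (intro arg_cong[of _ _ Determinant.det] eq_matI) auto
  also have "\<dots> = (\<Prod>i<n. ?c i i) * Determinant.det (Matrix.mat n n (\<lambda>(i, j). moment indet i j))"
    by (rule det_lower_triangular_mult) (simp add: coeff_eq_0 degree_lucas_poly)
  \<comment> \<open>Row 0 has diagonal entry 2 and the other \<open>lucas_poly\<close> are monic;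
    \<open>n >= 1\<close> guarantees that row 0 is present.\<close>
  also have "(\<Prod>i<n. ?c i i) = 2"
    using assms by (simp add: lead_coeff_lucas_poly prod.If_cases Int_absorb1 if_distrib prod.delta cong: if_cong)
  also have "Matrix.mat n n (\<lambda>(i, j). moment indet i j)
      = map_mat to_fract (Matrix.mat n n (\<lambda>(i, j). moment_poly i j))"
    using hom_moment_poly[OF to_fract_hom.comm_ring_hom_axioms]
    by (intro eq_matI) (auto simp: indet_def)
  finally show ?thesis
    by (simp add: moment_det_def to_fract_hom.hom_det)
qed

text \<open>The roots of the determinant are the negatives of the values of \<open>low_root\<close> and \<open>high_root\<close>.\<close>

definition low_index :: "nat \<Rightarrow> (nat \<times> nat) set" where
  "low_index n = Sigma {i. 2 * i < n} (\<lambda>i. {..<n - 2 * i - 1})"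

definition high_index :: "nat \<Rightarrow> (nat \<times> nat) set" where
  "high_index n = Sigma {i. 2 * i + 1 < n} (\<lambda>i. {..<n - 2 * i - 2})"

text \<open>A pair \<open>(i, k)\<close> stands for factor \<open>k\<close> of Pochhammer symbol
  \<open>i\<close>; indexing by pairs retains multiplicities.\<close>

definition low_root :: "nat \<times> nat \<Rightarrow> nat" where
  "low_root = (\<lambda>(i, k). 4 * i + 3 + k)"

definition high_root :: "nat \<Rightarrow> nat \<times> nat \<Rightarrow> nat" where
  "high_root n = (\<lambda>(i, k). 3 * n - 1 - 2 * i + k)"

lemma finite_index: "finite {i. 2 * i < n}" "finite {i. 2 * i + 1 < (n :: nat)}"
  "finite (low_index n)" "finite (high_index n)"
proof -
  show *: "finite {i. 2 * i < n}" "finite {i. 2 * i + 1 < n}"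
    by (auto intro: finite_subset[of _ "{..<n}"])
  then show "finite (low_index n)" "finite (high_index n)"
    by (auto simp: low_index_def high_index_def)
qed

text \<open>A pair \<open>(i, k)\<close> over \<open>s\<close> supplies the row vector of
  \<open>t^(2i+1) (1 + t)^k\<close>, of degree \<open>s - 2 - 2i\<close>. Different pairs over the
  same \<open>s\<close> give different degrees, hence the multiplicity.\<close>

lemma low_root_power_dvd:
  "[:of_nat s, 1:] ^ card {p \<in> low_index n. low_root p = s} dvd moment_det n"
proof -
  let ?P = "{p \<in> low_index n. low_root p = s}"
  define S where "S = (\<lambda>(i, k :: nat). s - 2 - 2 * i) ` ?P"
  have S: "\<exists>i. d = s - 2 - 2 * i \<and> 4 * i + 3 \<le> s \<and> s < n + 2 * i + 2" if "d \<in> S" for d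
    using that by (force simp: S_def low_index_def low_root_def)
  have card: "card ?P = card S"
    unfolding S_def
    by (rule card_image[symmetric]) (auto simp: inj_on_def low_index_def low_root_def)
  \<comment> \<open>In terms of the degree \<open>d\<close>, the exponents are
    \<open>2i + 1 = s - 1 - d\<close> and \<open>k = 2d + 1 - s\<close>.\<close>
  let ?p = "\<lambda>d. [:0, 1:] ^ (s - 1 - d) * [:1, 1:] ^ (2 * d + 1 - s) :: rat poly"
  have deg: "degree (?p d) = d" and lead: "lead_coeff (?p d) = 1" if d: "d \<in> S" for d
  proof -
    from S[OF d] obtain i where "d = s - 2 - 2 * i" "4 * i + 3 \<le> s"
      by blast
    then have "s - 1 - d + (2 * d + 1 - s) = d"
      by simp
    then show "degree (?p d) = d"
      by (subst degree_mult_eq) (auto simp: degree_power_eq)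
    show "lead_coeff (?p d) = 1"
      by (simp only: lead_coeff_mult lead_coeff_power) simp
  qed
  have "[:- (- of_nat s), 1:] ^ card S dvd moment_det n"
    unfolding moment_det_def
  proof (rule power_dvd_det_rows[where c = "\<lambda>d k. coeff (?p d) k"])
    show "S \<subseteq> {..<n}"
      using S by fastforce
    fix d
    assume d: "d \<in> S"
    show "coeff (?p d) d \<noteq> 0"
      using deg[OF d] lead[OF d] by simp
    show "coeff (?p d) k = 0" if "d < k" for k
      using deg[OF d] that by (simp add: coeff_eq_0)
    fix j
    assume "j < n"
    from S[OF d] obtain i where i: "d = s - 2 - 2 * i" "4 * i + 3 \<le> s" "s < n + 2 * i + 2"
      by blast
    have "(\<Sum>k<n. coeff (?p d) k * moment (- of_nat s) k j)
       = fps_nth (neg_binomial_fps (- of_nat s) * bilin_subst (?p d)) (2 * j)"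
      by (rule sum_coeff_moment) (use deg[OF d] i in simp)
    also have "\<dots> = 0"
      by (rule kernel_annihilates) (use i in auto)
    finally show "(\<Sum>k<n. coeff (?p d) k * poly (moment_poly k j) (- of_nat s)) = 0"
      by (simp add: poly_moment_poly)
  qed
  then show ?thesis
    by (simp add: card)
qed

text \<open>A pair \<open>(i, k)\<close> over \<open>s\<close> supplies a column vector ending at
  \<open>d = n - 1 - i\<close>, built with \<open>m = 2d + 1\<close> and \<open>g = 4d - s\<close>.
  The range \<open>0 <= k < n - 2i - 2\<close> says exactly that
  \<open>2d + n + 1 <= s <= 4d\<close>: then \<open>g\<close> is not truncated and the degree
  condition of \<open>cokernel_annihilates\<close> holds in every row.\<close>

lemma high_root_power_dvd:
  "[:of_nat s, 1:] ^ card {p \<in> high_index n. high_root n p = s} dvd moment_det n"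
proof -
  let ?P = "{p \<in> high_index n. high_root n p = s}"
  define S where "S = (\<lambda>(i, k :: nat). n - 1 - i) ` ?P"
  have S: "d < n \<and> s \<le> 4 * d \<and> 2 * d + n + 1 \<le> s" if "d \<in> S" for d
    using that by (auto simp: S_def high_index_def high_root_def)
  have card: "card ?P = card S"
    unfolding S_def
    by (rule card_image[symmetric]) (auto simp: inj_on_def high_index_def high_root_def)
  let ?K = "\<lambda>d. cokernel_fps (2 * d + 1) (4 * d - s) :: rat fps"
  have "[:- (- of_nat s), 1:] ^ card S dvd moment_det n"
    unfolding moment_det_def
  proof (rule power_dvd_det_cols[where c = "\<lambda>d k. if k \<le> d then fps_nth (?K d) (2 * (d - k)) else 0"])
    show "S \<subseteq> {..<n}"
      using S by auto
    fix d
    assume d: "d \<in> S"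
    show "(if d \<le> d then fps_nth (?K d) (2 * (d - d)) else 0) \<noteq> 0"
      by (simp add: cokernel_fps_def oct_fps_def fps_power_zeroth)
    show "(if k \<le> d then fps_nth (?K d) (2 * (d - k)) else 0) = 0" if "d < k" for k
      using that by simp
    fix i
    assume i: "i < n"
    have s: "s = Suc (s - 1)"
      using S[OF d] by simp
    have le: "4 * d - s + i + 3 \<le> 2 * d + 1"
      using S[OF d] i by linarith
    have "(\<Sum>k<n. (if k \<le> d then fps_nth (?K d) (2 * (d - k)) else 0) * moment (- of_nat s) i k)
       = (\<Sum>k\<le>d. fps_nth (?K d) (2 * (d - k)) * moment (- of_nat s) i k)"
      using S[OF d] by (intro sum.mono_neutral_cong_right) auto
    also have "\<dots> = fps_nth (?K d * (neg_binomial_fps (- of_nat s) * bilin_fps ^ i)) (2 * d)"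
      by (simp add: nth_even_mult_double[OF even_fps_cokernel] moment_def)
    also have "neg_binomial_fps (- of_nat s :: rat) = (1 - fps_X) ^ (s - 1)"
      by (subst s) (rule neg_binomial_fps_minus)
    also have "fps_nth (?K d * ((1 - fps_X) ^ (s - 1) * bilin_fps ^ i)) (2 * d) = 0"
      using cokernel_annihilates[OF _ le, of s, where ?'a = rat] S[OF d]
      by (simp add: mult.assoc)
    finally show "(\<Sum>k<n. (if k \<le> d then fps_nth (?K d) (2 * (d - k)) else 0)
        * poly (moment_poly i k) (- of_nat s)) = 0"
      by (simp add: poly_moment_poly)
  qed
  then show ?thesis
    by (simp add: card)
qed

section \<open>Assembling the roots\<close>

lemma prod_linear_dvd_nat:
  fixes e :: "'i \<Rightarrow> nat" and D :: "'a::{field_gcd,field_char_0} poly"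
  assumes "finite I" and D: "\<And>s. [:of_nat s, 1:] ^ card {p \<in> I. e p = s} dvd D"
  shows "(\<Prod>p\<in>I. [:of_nat (e p), 1:]) dvd D"
proof -
  have "[:- r, 1:] ^ card {p \<in> I. - of_nat (e p) = r} dvd D" for r :: 'a
  proof (cases "\<exists>s. r = - of_nat s")
    case True
    then show ?thesis
      using D by auto
  next
    case False
    then have empty: "{p \<in> I. - of_nat (e p) = r} = {}"
      by auto
    show ?thesis
      unfolding empty by simp
  qed
  from prod_linear_dvd[OF assms(1) this] show ?thesis by simp
qed

lemma sum_parity_split:
  fixes f :: "nat \<Rightarrow> 'a::comm_monoid_add"
  shows "(\<Sum>j<n. f j) = (\<Sum>i | 2 * i < n. f (2 * i)) + (\<Sum>i | 2 * i + 1 < n. f (2 * i + 1))"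
proof (induction n)
  case (Suc n)
  show ?case
  proof (cases "even n")
    case True
    then obtain m where m: "n = 2 * m" by (elim evenE)
    have sets: "{i. 2 * i < Suc n} = insert m {i. 2 * i < n}" "{i. 2 * i + 1 < Suc n} = {i. 2 * i + 1 < n}"
      using m by auto
    have "(\<Sum>i | 2 * i < Suc n. f (2 * i)) = f (2 * m) + (\<Sum>i | 2 * i < n. f (2 * i))"
      unfolding sets(1) by (rule sum.insert) (use m finite_index(1)[of n] in auto)
    moreover have "f n = f (2 * m)"
      using m by simp
    ultimately have "(\<Sum>j<Suc n. f j) = (\<Sum>i | 2 * i < Suc n. f (2 * i)) + (\<Sum>i | 2 * i + 1 < n. f (2 * i + 1))"
      using Suc by (simp only: sum.lessThan_Suc) (simp only: add_ac)
    then show ?thesis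
      by (simp only: sets(2))
  next
    case False
    then obtain m where m: "n = 2 * m + 1" by (elim oddE)
    have sets: "{i. 2 * i + 1 < Suc n} = insert m {i. 2 * i + 1 < n}"
        "{i. 2 * i < Suc n} = {i. 2 * i < n}"
      using m by auto presburger
    have "(\<Sum>i | 2 * i + 1 < Suc n. f (2 * i + 1)) = f (2 * m + 1) + (\<Sum>i | 2 * i + 1 < n. f (2 * i + 1))"
      unfolding sets(1) by (rule sum.insert) (use m finite_index(2)[of n] in auto)
    moreover have "f n = f (2 * m + 1)"
      using m by simp
    ultimately have "(\<Sum>j<Suc n. f j) = (\<Sum>i | 2 * i < n. f (2 * i)) + (\<Sum>i | 2 * i + 1 < Suc n. f (2 * i + 1))"
      using Suc by (simp only: sum.lessThan_Suc) (simp only: add_ac)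
    then show ?thesis
      by (simp only: sets(2))
  qed
qed simp

definition root_poly :: "nat \<Rightarrow> rat poly" where
  "root_poly n = (\<Prod>p\<in>low_index n. [:of_nat (low_root p), 1:])
     * (\<Prod>p\<in>high_index n. [:of_nat (high_root n p), 1:])"

lemma root_poly_dvd: "root_poly n dvd moment_det n"
  unfolding root_poly_def
proof (rule divides_mult)
  show "(\<Prod>p\<in>low_index n. [:of_nat (low_root p), 1:]) dvd moment_det n"
    by (intro prod_linear_dvd_nat low_root_power_dvd finite_index)
  show "(\<Prod>p\<in>high_index n. [:of_nat (high_root n p), 1:]) dvd moment_det n"
    by (intro prod_linear_dvd_nat high_root_power_dvd finite_index)
  \<comment> \<open>The low values are at most \<open>2n\<close> and the high ones at least
    \<open>2n + 1\<close>.\<close>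
  have "low_root p \<noteq> high_root n q" if "p \<in> low_index n" "q \<in> high_index n" for p q
    using that by (auto simp: low_index_def high_index_def low_root_def high_root_def)
  then have "coprime [:of_nat (low_root p), 1:] [:of_nat (high_root n q), 1 :: rat:]"
    if "p \<in> low_index n" "q \<in> high_index n" for p q
    using coprime_linear_poly[of "- of_nat (low_root p)" "- of_nat (high_root n q) :: rat"] that
    by auto
  then show "coprime (\<Prod>p\<in>low_index n. [:of_nat (low_root p), 1 :: rat:])
      (\<Prod>p\<in>high_index n. [:of_nat (high_root n p), 1:])"
    by (intro prod_coprime_left prod_coprime_right)
qed

lemma degree_root_poly: "degree (root_poly n) = \<Sum>{..<n}"
  and lead_coeff_root_poly: "lead_coeff (root_poly n) = 1"
proof -
  have "\<Sum>{..<n} = (\<Sum>j<n. n - 1 - j)"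
    by (rule sum.reindex_bij_witness[of _ "\<lambda>j. n - 1 - j" "\<lambda>j. n - 1 - j"]) auto
  \<comment> \<open>The summand \<open>n - 1 - j\<close> is the length of low symbol
    \<open>i\<close> for \<open>j = 2i\<close> and of high symbol \<open>i\<close> for
    \<open>j = 2i + 1\<close>.\<close>
  also have "\<dots> = card (low_index n) + card (high_index n)"
  proof -
    have "card (low_index n) = (\<Sum>i | 2 * i < n. n - 1 - 2 * i)"
      unfolding low_index_def by (subst card_SigmaI) (use finite_index(1)[of n] in simp_all)
    moreover have "card (high_index n) = (\<Sum>i | 2 * i + 1 < n. n - 1 - (2 * i + 1))"
      unfolding high_index_def by (subst card_SigmaI) (use finite_index(2)[of n] in simp_all)
    ultimately show ?thesis
      by (simp only: sum_parity_split)
  qed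
  also have "\<dots> = degree (root_poly n)"
    unfolding root_poly_def
    by (subst degree_mult_eq) (auto simp: degree_prod_sum_eq finite_index)
  finally show "degree (root_poly n) = \<Sum>{..<n}" ..
  show "lead_coeff (root_poly n) = 1"
    unfolding root_poly_def lead_coeff_mult lead_coeff_prod by simp
qed

text \<open>The degree bound equals the number of roots found, so the cofactor is constant, and the
  coefficient at that degree determines it.\<close>

lemma moment_det_eq:
  "moment_det n = smult (2 ^ \<Sum>{..<n} * (\<Prod>i<n. fact i / fact (2 * i))) (root_poly n)"
proof -
  let ?N = "\<Sum>{..<n}" and ?c = "2 ^ \<Sum>{..<n} * (\<Prod>i<n. fact i / fact (2 * i)) :: rat"
  have N: "?N + ?N = (\<Sum>j<n. 2 * j)"
    by (simp add: sum_distrib_left[symmetric])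
  have deg: "degree (moment_det n) \<le> ?N"
    unfolding moment_det_def
    by (rule det_graded(1)[where b = "\<lambda>j. 2 * j", OF _ _ N])
       (auto simp: degree_moment_poly moment_poly_eq_0)
  have coeff: "coeff (moment_det n) ?N = ?c"
    unfolding moment_det_def det_leading_coeffs[symmetric]
    by (rule det_graded(2)[where b = "\<lambda>j. 2 * j", OF _ _ N])
       (auto simp: degree_moment_poly moment_poly_eq_0)
  obtain q where q: "moment_det n = root_poly n * q"
    using root_poly_dvd[of n] by (elim dvdE)
  have "?c \<noteq> 0" by simp
  then have nz: "moment_det n \<noteq> 0"
    using coeff by (metis coeff_0)
  then have "degree (moment_det n) = ?N + degree q"
    using q by (simp add: degree_mult_eq degree_root_poly)
  then have "degree q = 0"
    using deg by simp
  then obtain c where c: "q = [:c:]"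
    by (elim degree_eq_zeroE)
  have "?c = c"
    using coeff q c lead_coeff_root_poly[of n] degree_root_poly[of n] by simp
  then show ?thesis
    using q c by simp
qed

subsection \<open>The two product formulas\<close>

definition low_prod :: "nat \<Rightarrow> 'a::field_char_0 \<Rightarrow> 'a" where
  "low_prod n x = (\<Prod>i | 2 * i < n. pochhammer (x + 4 * of_nat i + 3) (n - 2 * i - 1))"

text \<open>The argument \<open>y\<close> stands for \<open>x + 2n\<close>. With it separate, the
  factors depend on \<open>n\<close> only through \<open>n - 2i\<close>, and raising
  \<open>n\<close> by 1 at fixed \<open>x\<close> raises \<open>y\<close> by 2.\<close>

definition high_prod :: "nat \<Rightarrow> 'a::field_char_0 \<Rightarrow> 'a" where
  "high_prod n y = (\<Prod>i | 2 * i + 1 < n. pochhammer (y + of_nat (n - 2 * i - 1)) (n - 2 * i - 2))"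

lemma low_prod_Suc:
  "low_prod (Suc n) x = low_prod n x * (\<Prod>i | 2 * i < n. x + of_nat n + 2 + 2 * of_nat i)"
proof -
  \<comment> \<open>For even \<open>n\<close> the new index \<open>i = n / 2\<close> carries an
    empty Pochhammer symbol.\<close>
  have "low_prod (Suc n) x = (\<Prod>i | 2 * i < n. pochhammer (x + 4 * of_nat i + 3) (n - 2 * i))"
    unfolding low_prod_def
    using finite_index(1)[of "Suc n"] by (intro prod.mono_neutral_cong_right) auto
  also have "\<dots> = (\<Prod>i | 2 * i < n. pochhammer (x + 4 * of_nat i + 3) (n - 2 * i - 1)
      * (x + of_nat n + 2 + 2 * of_nat i))"
  proof (rule prod.cong)
    fix i
    assume "i \<in> {i. 2 * i < n}"
    then obtain d where d: "n = 2 * i + 1 + d"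
      by (auto dest: less_imp_Suc_add)
    then have "n - 2 * i = Suc d" by simp
    then show "pochhammer (x + 4 * of_nat i + 3) (n - 2 * i)
      = pochhammer (x + 4 * of_nat i + 3) (n - 2 * i - 1) * (x + of_nat n + 2 + 2 * of_nat i)"
      by (simp add: pochhammer_Suc) (simp add: d algebra_simps)
  qed simp
  finally show ?thesis
    by (simp add: low_prod_def prod.distrib)
qed

text \<open>Index \<open>i + 1\<close> at \<open>n + 2\<close> reproduces index \<open>i\<close> at
  \<open>n\<close>, so only \<open>i = 0\<close> is new.\<close>

lemma high_prod_add_2:
  "high_prod (n + 2) y = pochhammer (y + of_nat n + 1) n * high_prod n y"
proof -
  have "{i. 2 * i + 1 < n + 2} = insert 0 (Suc ` {i. 2 * i + 1 < n})"
  proof (rule Set.set_eqI)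
    show "i \<in> {i. 2 * i + 1 < n + 2} \<longleftrightarrow> i \<in> insert 0 (Suc ` {i. 2 * i + 1 < n})" for i
      by (cases i) auto
  qed
  then show ?thesis
    using finite_index(2)[of n]
    by (simp add: high_prod_def prod.reindex add_ac)
qed

text \<open>A single step changes the parity of \<open>n - 2i\<close>, so the comparison is proved
  by induction in steps of two. For \<open>y = x + 2n + 2\<close> the product over \<open>k\<close>
  supplies the factors \<open>x + n + 2 + 2k\<close> with \<open>2k >= n\<close>, complementing
  those of \<open>low_prod_Suc\<close>.\<close>

lemma high_prod_Suc:
  "high_prod (Suc n) y * pochhammer y n
    = high_prod n (y - 2) * (\<Prod>k | n \<le> 2 * k \<and> k < n. y - of_nat n + 2 * of_nat k)
      * pochhammer (y + of_nat n - 1) n"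
proof (induction n rule: nat_induct2)
  case 0
  then show ?case by (simp add: high_prod_def)
next
  case 1
  have empty: "{k. 1 \<le> 2 * k \<and> k < (1 :: nat)} = {}" "{i. 2 * i + 1 < (1 :: nat)} = {}"
    and single: "{i. 2 * i + 1 < Suc 1} = {0}"
    by auto
  show ?case
    unfolding high_prod_def empty single by simp
next
  case (step n)
  let ?g = "\<lambda>n. \<Prod>k | n \<le> 2 * k \<and> k < n. y - of_nat n + 2 * of_nat k"
  have g: "?g (n + 2) = ?g n * (y + of_nat n)"
  proof -
    have "?g (n + 2) = (\<Prod>k | n \<le> 2 * k \<and> k < Suc n. y - of_nat n + 2 * of_nat k)"
      by (rule prod.reindex_bij_witness[of _ Suc "\<lambda>k. k - 1"])
         (auto simp: of_nat_diff algebra_simps)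
    also have "{k. n \<le> 2 * k \<and> k < Suc n} = insert n {k. n \<le> 2 * k \<and> k < n}"
      by auto
    finally show ?thesis
      by (simp add: algebra_simps)
  qed
  have "high_prod (Suc (n + 2)) y * pochhammer y (n + 2)
     = pochhammer (y + of_nat n + 2) (Suc n) * (y + of_nat n) * (y + of_nat n + 1)
       * (high_prod (Suc n) y * pochhammer y n)"
    using high_prod_add_2[of "Suc n" y] by (simp add: pochhammer_Suc add_ac mult_ac)
  also have "\<dots> = pochhammer (y + of_nat n - 1) n * high_prod n (y - 2) * (?g n * (y + of_nat n))
      * ((y + of_nat n + 1) * pochhammer (y + of_nat n + 2) (Suc n))"
    unfolding step by (simp only: mult_ac)
  also have "(y + of_nat n + 1) * pochhammer (y + of_nat n + 2) (Suc n)
      = pochhammer (y + of_nat n + 1) (n + 2)"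
    using pochhammer_rec[of "y + of_nat n + 1" "Suc n"] by (simp add: add.assoc)
  also have "pochhammer (y + of_nat n - 1) n * high_prod n (y - 2) = high_prod (n + 2) (y - 2)"
    using high_prod_add_2[of n "y - 2"] by (simp add: algebra_simps)
  finally show ?case
    unfolding g by (simp add: algebra_simps)
qed

lemma pochhammer_double_step:
  "2 ^ n * pochhammer ((a :: 'a::field_char_0) / 2) n = (\<Prod>k<n. a + 2 * of_nat k)"
proof (induction n)
  case (Suc n)
  have "2 ^ Suc n * pochhammer (a / 2) (Suc n)
      = (2 ^ n * pochhammer (a / 2) n) * (2 * (a / 2 + of_nat n))"
    by (simp only: pochhammer_Suc power_Suc mult_ac)
  then show ?case
    unfolding Suc by (simp add: distrib_left)
qed simp

definition closed_form :: "nat \<Rightarrow> 'a::field_char_0 \<Rightarrow> 'a" where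
  "closed_form n x = 2 ^ (\<Sum>{..<n} + 1) * (\<Prod>i<n. fact i / fact (2 * i))
     * low_prod n x * high_prod n (x + 2 * of_nat n)"

text \<open>The new low factors (\<open>2k < n\<close>) and the high ones (\<open>2k >= n\<close>)
  merge into the product of all \<open>x + n + 2 + 2k\<close> with \<open>k < n\<close>, a
  Pochhammer symbol at half argument times \<open>2^n\<close>. The assumption on \<open>x\<close>
  keeps the denominator nonzero.\<close>

lemma closed_form_Suc:
  fixes x :: "'a::field_char_0"
  assumes "\<And>k. x + of_nat k \<noteq> 0"
  shows "closed_form (Suc n) x = closed_form n x
     * (2 ^ (2 * n) * inverse (pochhammer (of_nat n + 1) n)
        * inverse (pochhammer (x + 2 * of_nat n + 2) n)
        * pochhammer (x + 3 * of_nat n + 1) n * pochhammer ((x + of_nat n + 2) / 2) n)"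
proof -
  define y where "y = x + 2 * of_nat n + 2"
  let ?f = "\<lambda>k. x + of_nat n + 2 + 2 * of_nat k"
  let ?S = "\<Prod>k | 2 * k < n. ?f k" and ?g = "\<Prod>k | n \<le> 2 * k \<and> k < n. ?f k"
  let ?F = "fact n / fact (2 * n) :: 'a"
  have y: "pochhammer y n \<noteq> 0"
  proof
    assume "pochhammer y n = 0"
    then obtain k where "y = - of_nat k"
      by (auto simp: pochhammer_eq_0_iff)
    moreover have "x + of_nat (2 * n + 2 + k) = y + of_nat k"
      by (simp add: y_def add_ac)
    ultimately show False
      using assms[of "2 * n + 2 + k"] by simp
  qed
  have h: "high_prod (Suc n) y = high_prod n (x + 2 * of_nat n) * ?g
      * pochhammer (x + 3 * of_nat n + 1) n * inverse (pochhammer y n)"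
    using high_prod_Suc[of n y] y by (simp add: y_def field_simps)
  have "2 ^ n * pochhammer ((x + of_nat n + 2) / 2) n = (\<Prod>k<n. ?f k)"
    by (rule pochhammer_double_step)
  also have "\<dots> = ?S * ?g"
    by (subst prod.union_disjoint[symmetric])
       (auto intro!: prod.cong finite_subset[of _ "{..<n}"])
  finally have Sg: "2 ^ n * pochhammer ((x + of_nat n + 2) / 2) n = ?S * ?g" .
  have "fact (2 * n) = (fact n * pochhammer (of_nat n + 1) n :: 'a)"
    using pochhammer_product'[of "1 :: 'a" n n] by (simp add: pochhammer_fact mult_2 add_ac)
  then have F: "inverse (pochhammer (of_nat n + 1) n) = ?F"
    by (simp add: divide_simps)
  have "closed_form (Suc n) x = 2 ^ (\<Sum>{..<n} + 1) * 2 ^ n * (\<Prod>i<n. fact i / fact (2 * i)) * ?F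
      * (low_prod n x * ?S) * high_prod (Suc n) y"
    by (simp add: closed_form_def low_prod_Suc power_add y_def add_ac mult_ac)
  also have "\<dots> = closed_form n x * (2 ^ n * ?F * inverse (pochhammer y n)
        * pochhammer (x + 3 * of_nat n + 1) n * (?S * ?g))"
    unfolding h closed_form_def by (simp only: mult_ac)
  also have "\<dots> = closed_form n x * (2 ^ (2 * n) * ?F * inverse (pochhammer y n)
        * pochhammer (x + 3 * of_nat n + 1) n * pochhammer ((x + of_nat n + 2) / 2) n)"
  proof -
    have "2 ^ (2 * n) = (2 ^ n * 2 ^ n :: 'a)"
      by (simp add: mult_2 power_add)
    then show ?thesis
      unfolding Sg[symmetric] by (simp only: mult_ac)
  qed
  finally show ?thesis
    by (simp only: F y_def)
qed

text \<open>In factor \<open>i = n + 1\<close> the arguments of each Gamma quotient differ by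
  \<open>n\<close>, so the factor is the ratio given by \<open>closed_form_Suc\<close>, and the
  product telescopes.\<close>

lemma closed_form_eq_Gamma_quot:
  fixes x :: "'a::field_char_0"
  assumes "\<And>k. x + of_nat k \<noteq> 0"
  shows "closed_form n x = 2 * (\<Prod>i = 1..n.
        2 ^ (2 * i - 2)
        * Gamma_quot (of_nat i) (of_nat (2 * i - 1))
        * Gamma_quot (2 * of_nat i + x) (3 * of_nat i + x - 1)
        * Gamma_quot (4 * of_nat i + x - 3) (3 * of_nat i + x - 2)
        * Gamma_quot ((3 * of_nat i + x - 1) / 2) ((of_nat i + x + 1) / 2))"
proof (induction n)
  case 0
  then show ?case by (simp add: closed_form_def low_prod_def high_prod_def)
next
  case (Suc n)
  let ?i = "of_nat (Suc n) :: 'a"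
  have 1: "Gamma_quot ?i (of_nat (2 * Suc n - 1)) = inverse (pochhammer (of_nat n + 1) n)"
  proof -
    have "?i = of_nat n + 1" "of_nat (2 * Suc n - 1) = (of_nat n + 1) + (of_nat n :: 'a)"
      by simp_all
    then show ?thesis
      by (simp only: Gamma_quot_add_right)
  qed
  have 2: "Gamma_quot (2 * ?i + x) (3 * ?i + x - 1) = inverse (pochhammer (x + 2 * of_nat n + 2) n)"
  proof -
    have "2 * ?i + x = x + 2 * of_nat n + 2" "3 * ?i + x - 1 = x + 2 * of_nat n + 2 + of_nat n"
      by (simp_all add: algebra_simps)
    then show ?thesis
      by (simp only: Gamma_quot_add_right)
  qed
  have 3: "Gamma_quot (4 * ?i + x - 3) (3 * ?i + x - 2) = pochhammer (x + 3 * of_nat n + 1) n"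
  proof -
    have "4 * ?i + x - 3 = x + 3 * of_nat n + 1 + of_nat n" "3 * ?i + x - 2 = x + 3 * of_nat n + 1"
      by (simp_all add: algebra_simps)
    then show ?thesis
      by (simp only: Gamma_quot_add_left)
  qed
  have 4: "Gamma_quot ((3 * ?i + x - 1) / 2) ((?i + x + 1) / 2) = pochhammer ((x + of_nat n + 2) / 2) n"
  proof -
    have "(3 * ?i + x - 1) / 2 = (x + of_nat n + 2) / 2 + of_nat n" "(?i + x + 1) / 2 = (x + of_nat n + 2) / 2"
      by (simp_all add: field_simps)
    then show ?thesis
      by (simp only: Gamma_quot_add_left)
  qed
  have ivl: "(\<Prod>i = 1..Suc n. f i) = (\<Prod>i = 1..n. f i) * f (Suc n)" for f :: "nat \<Rightarrow> 'a"
    by simp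
  have 5: "2 * Suc n - 2 = 2 * n"
    by simp
  show ?case
    unfolding closed_form_Suc[OF assms] Suc ivl 1 2 3 4 5
    by (simp only: mult.assoc)
qed

section \<open>Transfer to rational functions\<close>

lemma moment_det_closed_form:
  "2 * to_fract (moment_det n) = closed_form n indet"
proof -
  define c :: "rat \<Rightarrow> rat poly fract" where "c = (\<lambda>a. to_fract [:a:])"
  have c_mult: "c (a * b) = c a * c b" for a b
    unfolding c_def to_fract_mult[symmetric] by simp
  have c_nat: "c (of_nat k) = of_nat k" for k
    unfolding c_def of_nat_poly[symmetric] by (rule to_fract_hom.hom_of_nat)
  have c_frac: "c (fact i / fact (2 * i)) = fact i / fact (2 * i)" for i
  proof -
    have "c (fact i / fact (2 * i)) * c (fact (2 * i)) = c (fact i)"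
      unfolding c_mult[symmetric] by simp
    then show ?thesis
      using c_nat[of "fact k" for k] by (simp add: field_simps)
  qed
  have c_prod: "c (\<Prod>i<m. f i) = (\<Prod>i<m. c (f i))" for f and m :: nat
    using c_nat[of 1] by (induction m) (simp_all add: c_mult)
  have c_pow: "c (2 ^ k) = 2 ^ k" for k
    using c_nat[of "2 ^ k"] by simp
  have lin: "to_fract [:of_nat s, 1:] = indet + of_nat s" for s
  proof -
    have "[:of_nat s, 1:] = [:0, 1:] + (of_nat s :: rat poly)"
      by (simp add: of_nat_poly)
    then show ?thesis
      by (simp add: indet_def to_fract_hom.hom_of_nat)
  qed
  have "to_fract (\<Prod>p\<in>low_index n. [:of_nat (low_root p), 1:])
     = (\<Prod>(i, k)\<in>low_index n. indet + 4 * of_nat i + 3 + of_nat k)"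
    unfolding to_fract_hom.hom_prod lin
    by (simp add: low_root_def case_prod_unfold add_ac)
  also have "\<dots> = low_prod n indet"
    unfolding low_index_def low_prod_def pochhammer_prod
    by (subst prod.Sigma[symmetric]) (use finite_index(1)[of n] in \<open>auto simp: lessThan_atLeast0\<close>)
  finally have low: "to_fract (\<Prod>p\<in>low_index n. [:of_nat (low_root p), 1:]) = low_prod n indet" .
  have "to_fract (\<Prod>p\<in>high_index n. [:of_nat (high_root n p), 1:])
     = (\<Prod>(i, k)\<in>high_index n. indet + 2 * of_nat n + of_nat (n - 2 * i - 1) + of_nat k)"
    unfolding to_fract_hom.hom_prod
  proof (rule prod.cong)
    fix p
    assume p: "p \<in> high_index n"
    then have "high_root n p = 2 * n + (n - 2 * fst p - 1) + snd p"
      by (auto simp: high_index_def high_root_def)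
    then show "to_fract [:of_nat (high_root n p), 1:]
      = (case p of (i, k) \<Rightarrow> indet + 2 * of_nat n + of_nat (n - 2 * i - 1) + of_nat k)"
      unfolding lin by (simp add: case_prod_unfold add_ac)
  qed simp
  also have "\<dots> = high_prod n (indet + 2 * of_nat n)"
    unfolding high_index_def high_prod_def pochhammer_prod
    by (subst prod.Sigma[symmetric]) (use finite_index(2)[of n] in \<open>auto simp: lessThan_atLeast0\<close>)
  finally have high: "to_fract (\<Prod>p\<in>high_index n. [:of_nat (high_root n p), 1:])
     = high_prod n (indet + 2 * of_nat n)" .
  have smult: "to_fract (smult a p) = c a * to_fract p" for a p
    unfolding c_def to_fract_mult[symmetric] by simp
  show ?thesis
    by (simp add: moment_det_eq smult root_poly_def low high c_mult c_pow c_prod c_frac closed_form_def)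
qed

lemma indet_add_of_nat_neq_0: "indet + of_nat k \<noteq> 0"
proof -
  have "indet + of_nat k = to_fract ([:0, 1:] + of_nat k)"
    by (simp add: indet_def to_fract_hom.hom_of_nat)
  also have "\<dots> \<noteq> 0"
    by (simp add: of_nat_poly)
  finally show ?thesis .
qed

theorem theorem8:
  fixes n :: nat
  assumes "n \<ge> 1"
  shows "D3 n indet =
      2 ^ ((n choose 2) + 1)
      * (\<Prod>i = 0..n - 1. fact i / fact (2 * i))
      * (\<Prod>i = 0..(n - 1) div 2. pochhammer (indet + 4 * of_nat i + 3) (n - 2 * i - 1))
      * (\<Prod>i \<in> {i. 2 * i + 2 \<le> n}.
           pochhammer (indet - 2 * of_nat i + 3 * of_nat n - 1) (n - 2 * i - 2))
    \<and> D3 n indet =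
      2 * (\<Prod>i = 1..n.
        2 ^ (2 * i - 2)
        * Gamma_quot (of_nat i) (of_nat (2 * i - 1))
        * Gamma_quot (2 * of_nat i + indet) (3 * of_nat i + indet - 1)
        * Gamma_quot (4 * of_nat i + indet - 3) (3 * of_nat i + indet - 2)
        * Gamma_quot ((3 * of_nat i + indet - 1) / 2) ((of_nat i + indet + 1) / 2))"
proof
  have D3: "D3 n indet = closed_form n indet"
    by (simp only: D3_eq_moment_det[OF assms] moment_det_closed_form)
  have "\<Sum>{..<n} = n choose 2"
    by (induction n) (simp_all add: numeral_2_eq_2)
  moreover have "{..<n} = {0..n - 1}" "{i. 2 * i < n} = {0..(n - 1) div 2}"
    using assms by auto
  \<comment> \<open>For \<open>n = 1\<close> the index set is empty, matching the product with upper
    limit -1.\<close>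
  moreover have "high_prod n (indet + 2 * of_nat n) = (\<Prod>i \<in> {i. 2 * i + 2 \<le> n}.
           pochhammer (indet - 2 * of_nat i + 3 * of_nat n - 1) (n - 2 * i - 2))"
    unfolding high_prod_def
    by (intro prod.cong arg_cong2[of _ _ _ _ pochhammer]) (auto simp: of_nat_diff algebra_simps)
  ultimately show "D3 n indet =
      2 ^ ((n choose 2) + 1)
      * (\<Prod>i = 0..n - 1. fact i / fact (2 * i))
      * (\<Prod>i = 0..(n - 1) div 2. pochhammer (indet + 4 * of_nat i + 3) (n - 2 * i - 1))
      * (\<Prod>i \<in> {i. 2 * i + 2 \<le> n}.
           pochhammer (indet - 2 * of_nat i + 3 * of_nat n - 1) (n - 2 * i - 2))"
    by (simp only: D3 closed_form_def low_prod_def)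
  show "D3 n indet =
      2 * (\<Prod>i = 1..n.
        2 ^ (2 * i - 2)
        * Gamma_quot (of_nat i) (of_nat (2 * i - 1))
        * Gamma_quot (2 * of_nat i + indet) (3 * of_nat i + indet - 1)
        * Gamma_quot (4 * of_nat i + indet - 3) (3 * of_nat i + indet - 2)
        * Gamma_quot ((3 * of_nat i + indet - 1) / 2) ((of_nat i + indet + 1) / 2))"
    unfolding D3 by (rule closed_form_eq_Gamma_quot) (rule indet_add_of_nat_neq_0)
qed

end
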